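(* There is an absolute constant $C$ such that for every integer $n\ge2$ and every $0<\epsilon<1$ there is a block size $m\in\mathbb{N}$ with $1\le m\le C\log(n/\epsilon)$ for which the optimistic QFT circuit on $n$ qubits with block size $m$ (defined in the context) is an optimistic circuit with error parameter $\epsilon$ for $\mathsf{QFT}_{2^n}$; that is, the unitary $\widetilde{\mathsf{QFT}}$ it induces satisfies $$\frac{1}{2^n}\big\|\widetilde{\mathsf{QFT}}-\mathsf{QFT}_{2^n}\big\|_F^2\le\epsilon .$$
   Context: $\|A\|_F^2=\mathrm{Tr}[A^\dagger A]$. An optimistic circuit with error parameter $\epsilon$ for a unitary $\mathcal{U}$ on $\mathcal{H}$ is a circuit inducing a unitary $\widetilde{\mathcal{U}}$ with $\|\widetilde{\mathcal{U}}-\mathcal{U}\|_F^2/\dim\mathcal{H}\le\epsilon$. Endianness conventions. For a block of $k$ consecutive qubits in a computational basis state with bits $b_0,\dots,b_{k-1}$ (in qubit order), its input reading is $\sum_{j}2^{k-1-j}b_j$ and its output reading is $\sum_j2^{j}b_j$. The unitary $\mathsf{QFT}_{2^k}$ on these qubits maps the basis state with input reading $x$ to $2^{-k/2}\sum_{y=0}^{2^k-1}e^{2\pi ixy/2^k}|y\rangle$, where $|y\rangle$ is the basis state with output reading $y$. (So $\mathsf{QFT}_{2^k}$ is the usual QFT modulo $2^k$ up to bit reversal.) Optimistic QFT circuit. Divide the $n$ qubits, in order, into $B=\lceil n/m\rceil$ consecutive blocks indexed $0,\dots,B-1$, block $i$ having $m_i$ qubits, where $m_i=m$ for $i<B-1$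 and the last block has the remaining qubits. For $0\le i\le B-2$, the phase rotation between blocks $i$ and $i+1$ is the diagonal unitary multiplying each computational basis state by $\exp(2\pi\mathrm{i}\,X_{i+1}Y_i/2^{m_i+m_{i+1}})$, where $X_{i+1}$ is the input reading of block $i+1$ and $Y_i$ is the output reading of block $i$ (so the denominator is $2^{2m}$ when both blocks have size $m$). The circuit performs, in order: 1. Apply $\mathsf{QFT}_{2^{m_i}}$ to every even-indexed block $i$. 2. Apply the phase rotation between blocks $i$ and $i+1$ for all even $i\le B-2$. 3. Apply $\mathsf{QFT}_{2^{m_i}}$ to every odd-indexed block, and $\mathsf{QFT}_{2^{m_i}}^\dagger$ to every even-indexed block. 4. Apply the phase rotation between blocks $i$ and $i+1$ for all odd $i\le B-2$. 5. Apply $\mathsf{QFT}_{2^{m_i}}$ to every even-indexed block. *)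

theory Defs
  imports Complex_Main "Jordan_Normal_Form.Schur_Decomposition"
begin

definition mat_trace :: "complex mat \<Rightarrow> complex" where
  "mat_trace A = (\<Sum>i<dim_row A. A $$ (i, i))"

definition frobenius_norm :: "complex mat \<Rightarrow> real" where
  "frobenius_norm A = sqrt (Re (mat_trace (mat_adjoint A * A)))"

definition unitary_mat :: "nat \<Rightarrow> complex mat \<Rightarrow> bool" where
  "unitary_mat d U \<longleftrightarrow>
     U \<in> carrier_mat d d \<and> mat_adjoint U * U = 1\<^sub>m d \<and> U * mat_adjoint U = 1\<^sub>m d"

text \<open>A circuit on a \<open>d\<close>-dimensional space is the list of its operations, the one applied
  first at the head; the induced matrix is therefore the product in reverse order.\<close>

definition induced_mat :: "nat \<Rightarrow> complex mat list \<Rightarrow> complex mat" where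
  "induced_mat d gs = fold (\<lambda>G U. G * U) gs (1\<^sub>m d)"

definition optimistic_circuit :: "nat \<Rightarrow> real \<Rightarrow> complex mat list \<Rightarrow> complex mat \<Rightarrow> bool" where
  "optimistic_circuit d \<epsilon> gs U \<longleftrightarrow>
     unitary_mat d U \<and> unitary_mat d (induced_mat d gs) \<and>
     (frobenius_norm (induced_mat d gs - U))\<^sup>2 / real d \<le> \<epsilon>"

text \<open>The computational basis states of \<open>n\<close> qubits are indexed by \<open>s < 2 ^ n\<close>. Qubit \<open>0\<close> is the
  most significant bit of the index, as in the Kronecker product.\<close>

definition qubit :: "nat \<Rightarrow> nat \<Rightarrow> nat \<Rightarrow> nat" where
  "qubit n s j = of_bool (bit s (n - 1 - j))"

text \<open>Readings of the block formed by the \<open>k\<close> qubits \<open>a, \<dots>, a + k - 1\<close>.\<close>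

definition in_reading :: "nat \<Rightarrow> nat \<Rightarrow> nat \<Rightarrow> nat \<Rightarrow> nat" where
  "in_reading n a k s = (\<Sum>j<k. 2 ^ (k - 1 - j) * qubit n s (a + j))"

definition out_reading :: "nat \<Rightarrow> nat \<Rightarrow> nat \<Rightarrow> nat \<Rightarrow> nat" where
  "out_reading n a k s = (\<Sum>j<k. 2 ^ j * qubit n s (a + j))"

text \<open>The QFT on the qubits \<open>a, \<dots>, a + k - 1\<close>, tensored with the identity on the other qubits.
  The entry at row \<open>t\<close> and column \<open>s\<close> is the amplitude of \<open>t\<close> in the image of \<open>s\<close>.\<close>

definition QFT_on :: "nat \<Rightarrow> nat \<Rightarrow> nat \<Rightarrow> complex mat" where
  "QFT_on n a k = mat (2 ^ n) (2 ^ n) (\<lambda>(t, s).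
     if \<forall>j<n. j \<notin> {a..<a + k} \<longrightarrow> qubit n t j = qubit n s j
     then of_real (2 powr (- real k / 2)) *
          exp (2 * of_real pi * \<i> * of_nat (in_reading n a k s) * of_nat (out_reading n a k t)
               / 2 ^ k)
     else 0)"

definition QFT :: "nat \<Rightarrow> complex mat" where
  "QFT n = QFT_on n 0 n"

definition num_blocks :: "nat \<Rightarrow> nat \<Rightarrow> nat" where
  "num_blocks n m = nat \<lceil>real n / real m\<rceil>"

definition block_start :: "nat \<Rightarrow> nat \<Rightarrow> nat" where
  "block_start m i = i * m"

definition block_size :: "nat \<Rightarrow> nat \<Rightarrow> nat \<Rightarrow> nat" where
  "block_size n m i =
     (if i < num_blocks n m - 1 then m else n - block_start m (num_blocks n m - 1))"

definition block_QFT :: "nat \<Rightarrow> nat \<Rightarrow> nat \<Rightarrow> complex mat" where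
  "block_QFT n m i = QFT_on n (block_start m i) (block_size n m i)"

definition phase_rotation :: "nat \<Rightarrow> nat \<Rightarrow> nat \<Rightarrow> complex mat" where
  "phase_rotation n m i = mat_diag (2 ^ n) (\<lambda>s.
     exp (2 * of_real pi * \<i> *
          of_nat (in_reading n (block_start m (i + 1)) (block_size n m (i + 1)) s) *
          of_nat (out_reading n (block_start m i) (block_size n m i) s)
          / 2 ^ (block_size n m i + block_size n m (i + 1))))"

definition optimistic_QFT :: "nat \<Rightarrow> nat \<Rightarrow> complex mat list" where
  "optimistic_QFT n m =
     (let blocks = [0..<num_blocks n m]; pairs = [0..<num_blocks n m - 1] in
      map (block_QFT n m) (filter even blocks) @
      map (phase_rotation n m) (filter even pairs) @
      map (block_QFT n m) (filter odd blocks) @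
      map (\<lambda>i. mat_adjoint (block_QFT n m i)) (filter even blocks) @
      map (phase_rotation n m) (filter odd pairs) @
      map (block_QFT n m) (filter even blocks))"

end

theory Submission
  imports Defs "HOL-Analysis.Convex" "HOL-Library.FuncSet"
begin

text \<open>
  Dropping from the QFT the phases between blocks at distance at least two changes every
  amplitude by a relative phase of at most \<open>2 \<pi> n / 2 ^ m\<close>. The circuit would induce this truncated
  QFT if on every even block \<open>j\<close> the phase \<open>D\<close> coming from block \<open>j - 1\<close>, diagonal in the
  computational basis, commuted with the operator \<open>Q\<close> obtained by conjugating the phase towards
  block \<open>j + 1\<close> with the QFT of the block. In the computational basis \<open>Q\<close> is a Dirichlet kernel
  concentrated near the (cyclic) diagonal, where the entries of \<open>D\<close> differ by \<open>O(2 ^ - m)\<close>, except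
  for the few pairs of indices that wrap around. Hence the commutator has normalised squared Frobenius
  norm \<open>O(m\<^sup>2 / 2 ^ m)\<close>, and the worst case over inputs, where the circuit can fail, is averaged
  out. Taking \<open>m\<close> a large multiple of \<open>ln (n / \<epsilon>)\<close> beats the factor \<open>n\<^sup>2\<close> lost when summing over the blocks.
\<close>
section \<open>The Dirichlet kernel against a slowly varying phase\<close>

text \<open>Step 4 of the circuit needs the input readings of the even blocks, although step 1 has
  already transformed these blocks to give step 2 their output readings. Step 3 transforms them
  back, but the phase applied in between turns the round trip into a translation of the reading by a
  fraction \<theta> in [0, 1), which is read off the right neighbour. A fractional translation
  smears an integer reading out, with amplitudes that decay only like 1 / |a - b|. The phase
  difference grows like |a - b| / 2 ^ m and compensates this, so that a typical pair of readings
  contributes O(4 ^ -m) in square. Pairs at opposite ends of the range are close for the kernel but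
  far apart for the phase; there the decay alone has to suffice, and it produces the harmonic sums
  behind the power of m. For a fixed input the round trip yields a product state, so every estimate
  takes place inside one block. One factor n comes from Cauchy-Schwarz over the pairs of blocks, the
  other from summing over them.\<close>

definition expi :: "real \<Rightarrow> complex" where
  "expi x = cis (2 * pi * x)"

lemma expi_add: "expi (x + y) = expi x * expi y"
  by (simp add: expi_def cis_mult algebra_simps)

lemma expi_sum: "expi (\<Sum>i\<in>A. f i) = (\<Prod>i\<in>A. expi (f i))"
  by (induction A rule: infinite_finite_induct) (simp_all add: expi_add, simp_all add: expi_def)

lemma norm_expi [simp]: "norm (expi x) = 1"
  by (simp add: expi_def)

lemma cnj_expi [simp]: "cnj (expi x) = expi (- x)"
  by (simp add: expi_def cis_cnj)

lemma expi_of_nat [simp]: "expi (real k) = 1"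
  using cis_multiple_2pi[of "real k"] by (simp add: expi_def mult.commute)

lemma expi_0 [simp]: "expi 0 = 1"
  by (simp add: expi_def)

lemma expi_power: "expi x ^ k = expi (real k * x)"
  by (simp add: expi_def DeMoivre algebra_simps)

lemma exp_eq_expi:
  "exp (2 * of_real pi * \<i> * of_nat a * of_nat b / 2 ^ k) = expi (real a * real b / 2 ^ k)"
  by (simp add: expi_def cis_conv_exp algebra_simps)

lemma norm_expi_diff: "norm (expi x - expi y) = 2 * \<bar>sin (pi * (x - y))\<bar>"
proof -
  have "norm (cis (2 * t) - 1) = 2 * \<bar>sin t\<bar>" for t
  proof (rule power2_eq_imp_eq)
    show "(norm (cis (2 * t) - 1))\<^sup>2 = (2 * \<bar>sin t\<bar>)\<^sup>2"
      unfolding cmod_power2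
      by (simp add: cos_double_sin sin_double power_mult_distrib cos_squared_eq)
         (simp add: power2_eq_square power4_eq_xxxx algebra_simps)
  qed auto
  from this[of "pi * (x - y)"] have "norm (expi (x - y) - 1) = 2 * \<bar>sin (pi * (x - y))\<bar>"
    by (simp add: expi_def algebra_simps)
  moreover have "expi x - expi y = expi y * (expi (x - y) - 1)"
    using expi_add[of y "x - y"] by (simp add: algebra_simps)
  ultimately show ?thesis
    by (simp add: norm_mult)
qed

lemma norm_expi_diff_le: "norm (expi x - expi y) \<le> 2 * pi * \<bar>x - y\<bar>"
  using abs_sin_x_le_abs_x[of "pi * (x - y)"] by (simp add: norm_expi_diff abs_mult)

text \<open>Jordan's inequality: by concavity the sine lies above its chord on [0, pi / 2].\<close>

lemma sin_ge_linear:
  assumes "0 \<le> t" "t \<le> 1"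
  shows "t \<le> sin (pi / 2 * t)"
proof -
  have "concave_on {0..pi / 2} (\<lambda>x. sin x)"
  proof (rule f''_le0_imp_concave)
    show "(sin has_real_derivative cos x) (at x)" for x :: real
      by (rule DERIV_sin)
    show "(cos has_real_derivative - sin x) (at x)" for x :: real
      by (rule DERIV_cos)
    show "- sin x \<le> 0" if "x \<in> {0..pi / 2}" for x
      using that sin_ge_zero[of x] by auto
  qed simp
  from concave_onD[OF this, of t 0 "pi / 2"] show ?thesis
    using assms by (simp add: mult.commute)
qed

text \<open>A geometric sum: multiplied by \<open>1 - expi u\<close> it telescopes to a number of
  norm at most 2, and \<open>1 - expi u\<close> has norm 2 |sin (pi u)|. The product form also
  covers integral \<open>u\<close>.\<close>

lemma norm_sum_expi_sin_le: "norm (\<Sum>y<M. expi (real y * u)) * \<bar>sin (pi * u)\<bar> \<le> 1"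
proof -
  have "(\<Sum>y<M. expi (real y * u)) * (1 - expi u) = 1 - expi (real M * u)"
    using one_diff_power_eq[of "expi u" M] by (simp add: expi_power mult.commute)
  then have "norm (\<Sum>y<M. expi (real y * u)) * norm (expi 0 - expi u) = norm (1 - expi (real M * u))"
    by (simp flip: norm_mult)
  also have "\<dots> \<le> 2"
    using norm_triangle_ineq4[of 1 "expi (real M * u)"] by simp
  finally show ?thesis
    unfolding norm_expi_diff by simp
qed

lemma norm_sum_expi_le: "norm (\<Sum>y<M. expi (f y)) \<le> real M"
  using norm_sum[of "\<lambda>y. expi (f y)" "{..<M}"] by simp

text \<open>The sine bound controls the kernel by the distance of \<open>b - a + \<theta>\<close> to
  the nearest multiple of \<open>M\<close>. The two alternatives say whether that multiple is 0 or
  plus or minus \<open>M\<close>; as products they also make sense for \<open>d = 0\<close>.\<close>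

lemma dirichlet_kernel_le:
  fixes a b M :: nat
  assumes ab: "a < M" "b < M" and \<theta>: "0 \<le> \<theta>" "\<theta> < 1"
  defines "d \<equiv> \<bar>real a - real b\<bar>"
  defines "S \<equiv> norm (\<Sum>y<M. expi (real y * ((real b - real a + \<theta>) / real M)))"
  shows "S * d \<le> real M \<or> S * (real M - d) \<le> real M"
proof -
  define v where "v = \<bar>real b - real a + \<theta>\<bar>"
  have M: "real M > 0" using ab by simp
  have vM: "v \<le> M" and vd: "d - 1 \<le> v" "v \<le> d + 1"
    using ab \<theta> unfolding v_def d_def by linarith+
  have S: "0 \<le> S" "S \<le> M"
    unfolding S_def by (auto intro: norm_sum_expi_le)
  \<comment> \<open>The shift \<theta> can cost up to 1 in the distance. For
    \<open>e \<ge> 2\<close> one has e - 1 \<ge> e / 2, and the lost factor 2 is paid by the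
    \<open>M / 2\<close> in the premise; for \<open>e \<le> 1\<close> the trivial bound
    \<open>S \<le> M\<close> suffices. Integrality of \<open>e\<close> rules out the values in
    between.\<close>
  have spread: "S * e \<le> M" if e: "S * w \<le> real M / 2" "e - 1 \<le> w" "e \<le> 1 \<or> e \<ge> 2" for e w
  proof (cases "e \<le> 1")
    case True
    then show ?thesis using S mult_left_mono[of e 1 S] by simp
  next
    case False
    then have "S * (e / 2) \<le> S * w" using e S by (intro mult_left_mono) auto
    with e show ?thesis by simp
  qed
  have d: "d = \<bar>int a - int b\<bar>" by (simp add: d_def)
  have int: "e \<le> 1 \<or> e \<ge> 2" if "e = real_of_int k" for e k
    using that by (cases "k \<le> 1") auto
  have sv: "S * sin (pi * (v / M)) \<le> 1"
  proof -
    have "\<bar>sin (pi * ((real b - real a + \<theta>) / M))\<bar> = \<bar>sin (pi * (v / M))\<bar>"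
    proof (cases "real b - real a + \<theta> \<ge> 0")
      case False
      then have "pi * (v / M) = - (pi * ((real b - real a + \<theta>) / M))"
        unfolding v_def by (simp add: algebra_simps diff_divide_distrib add_divide_distrib)
      then show ?thesis by simp
    qed (simp add: v_def)
    moreover have "sin (pi * (v / M)) \<ge> 0"
      using vM M by (intro sin_ge_zero) (auto simp: v_def field_simps)
    ultimately show ?thesis
      using norm_sum_expi_sin_le[of "(real b - real a + \<theta>) / real M" M] by (simp add: S_def)
  qed
  show ?thesis
  proof (cases "v \<le> M / 2")
    case True
    then have "2 * v / M \<le> sin (pi / 2 * (2 * v / M))"
      using M by (intro sin_ge_linear) (auto simp: v_def field_simps)
    then have "S * (2 * v / M) \<le> S * sin (pi * (v / M))"
      using S by (intro mult_left_mono) auto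
    then have "S * (2 * v / M) \<le> 1"
      using sv by linarith
    then have "S * v \<le> M / 2" using M by (simp add: field_simps)
    from spread[OF this] show ?thesis using vd int[OF d] by auto
  next
    case False
    then have "2 * (M - v) / M \<le> sin (pi / 2 * (2 * (M - v) / M))"
      using M vM by (intro sin_ge_linear) (auto simp: v_def field_simps)
    also have "pi / 2 * (2 * (M - v) / M) = pi - pi * (v / M)"
      using M by (simp add: field_simps)
    finally have "S * (2 * (M - v) / M) \<le> S * sin (pi * (v / M))"
      using S by (intro mult_left_mono) auto
    then have "S * (2 * (M - v) / M) \<le> 1"
      using sv by linarith
    then have "S * (M - v) \<le> M / 2" using M by (simp add: field_simps)
    from spread[OF this, of "M - d"] show ?thesis
      using vd int[of "M - d" "int M - \<bar>int a - int b\<bar>"] by (auto simp: d)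
  qed
qed

text \<open>Bounds how far a neighbour phase moves when a reading changes from \<open>b\<close> to
  \<open>a\<close>: a chord of the unit circle is at most its arc and at most the diameter
  2.\<close>

definition phase_gap :: "nat \<Rightarrow> nat \<Rightarrow> nat \<Rightarrow> real" where
  "phase_gap M a b = min 2 (2 * pi * \<bar>real a - real b\<bar> / real M)"

definition commutator_bound :: "nat \<Rightarrow> nat \<Rightarrow> nat \<Rightarrow> real" where
  "commutator_bound M a b = 4 * pi\<^sup>2 / (real M)\<^sup>2 + 4 / (real M - \<bar>real a - real b\<bar>)\<^sup>2"

text \<open>Near the diagonal the distance in the gap cancels the decay of the kernel and leaves 2
  pi / M. For pairs that wrap around, the gap is only known to be at most 2 and the kernel supplies
  1 / (M - d). The sum of both squares covers either case.\<close>

lemma phase_gap_dirichlet_le: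
  assumes ab: "a < M" "b < M" and \<theta>: "0 \<le> \<theta>" "\<theta> < 1"
  shows "(phase_gap M a b)\<^sup>2 *
      (norm (\<Sum>y<M. expi (real y * ((real b - real a + \<theta>) / real M))) / real M)\<^sup>2
    \<le> commutator_bound M a b"
proof -
  define d where "d = \<bar>real a - real b\<bar>"
  define S where "S = norm (\<Sum>y<M. expi (real y * ((real b - real a + \<theta>) / real M)))"
  have M: "real M > 0" and S: "S \<ge> 0" and d: "0 \<le> d" "d < M"
    using ab by (auto simp: S_def d_def)
  have g: "phase_gap M a b \<ge> 0" "phase_gap M a b \<le> 2" "phase_gap M a b \<le> 2 * pi * d / M"
    using d by (auto simp: phase_gap_def d_def)
  have "phase_gap M a b * (S / M) \<le> 2 * pi / M \<or> phase_gap M a b * (S / M) \<le> 2 / (M - d)"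
    using dirichlet_kernel_le[OF ab \<theta>]
  unfolding d_def[symmetric] S_def[symmetric]
  proof (elim disjE)
    assume *: "S * d \<le> M"
    have "phase_gap M a b * (S / M) \<le> (2 * pi * d / M) * (S / M)"
      using g S by (intro mult_right_mono) auto
    also have "\<dots> = 2 * pi / M * ((S * d) / M)" using M by (simp add: field_simps)
    also have "\<dots> \<le> 2 * pi / M * 1"
      using * M by (intro mult_left_mono) auto
    finally show ?thesis by simp
  next
    assume *: "S * (M - d) \<le> M"
    then have "S / M \<le> 1 / (M - d)" using M d by (simp add: field_simps)
    then have "phase_gap M a b * (S / M) \<le> 2 * (1 / (M - d))"
      using g S M by (intro mult_mono) auto
    then show ?thesis by simp
  qed
  then have "(phase_gap M a b * (S / M))\<^sup>2 \<le> (2 * pi / M)\<^sup>2 \<or>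
      (phase_gap M a b * (S / M))\<^sup>2 \<le> (2 / (M - d))\<^sup>2"
    using g S M by (auto intro: power_mono)
  then show ?thesis
    unfolding commutator_bound_def S_def[symmetric] d_def[symmetric]
    by (auto simp: power_mult_distrib power_divide intro: order_trans)
qed

text \<open>Each doubling of the range adds 2 ^ m terms of size at most 1 / 2 ^ m.\<close>

lemma harmonic_sum_le: "(\<Sum>k<2 ^ m. 1 / (real k + 1)) \<le> real m + 1"
proof (induction m)
  case (Suc m)
  have "(\<Sum>k<2 ^ Suc m. 1 / (real k + 1)) =
      (\<Sum>k<2 ^ m. 1 / (real k + 1)) + (\<Sum>k=2 ^ m..<2 ^ Suc m. 1 / (real k + 1))"
    by (subst sum.union_disjoint[symmetric]) (auto intro!: sum.cong)
  also have "(\<Sum>k=2 ^ m..<2 ^ Suc m. 1 / (real k + 1)) \<le> (\<Sum>k=2 ^ m..<(2::nat) ^ Suc m. 1 / 2 ^ m)"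
  proof (intro sum_mono divide_left_mono)
    fix k :: nat
    assume "k \<in> {2 ^ m..<2 ^ Suc m}"
    then have "real (2 ^ m) \<le> real k" unfolding of_nat_le_iff by simp
    then show "2 ^ m \<le> real k + 1" unfolding of_nat_power of_nat_numeral by linarith
  qed auto
  also have "\<dots> = 1" by simp
  finally show ?case using Suc by simp
qed simp

text \<open>A total over all 4 ^ m pairs, so the mean over the columns \<open>b\<close> is O(m^2 / 2
  ^ m). The first term of the bound is constant in \<open>a\<close> and \<open>b\<close> and sums to
  exactly 4 pi^2.\<close>

lemma sum_commutator_bound_le:
  "(\<Sum>b<2 ^ m. \<Sum>a<2 ^ m. commutator_bound (2 ^ m) a b) \<le> 4 * pi\<^sup>2 + 8 * (real m + 1)\<^sup>2"
proof -
  define M where "M = (2::nat) ^ m"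
  have M: "real M > 0" by (simp add: M_def)
  define f where "f a b = 4 / ((real M - real a) * (real b + 1))" for a b
  \<comment> \<open>\<open>M - (c - d) = (M - c) + d\<close> is at least \<open>M - c\<close> and at least \<open>d + 1\<close>, so the double sum factors
    into harmonic sums.\<close>
  have *: "4 / (real M - \<bar>real a - real b\<bar>)\<^sup>2 \<le> f a b + f b a" if "a < M" "b < M" for a b
  proof -
    have le: "4 / (real M - (real c - real d))\<^sup>2 \<le> f c d" if "c < M" "d \<le> c" for c d
      unfolding f_def power2_eq_square using that by (intro divide_left_mono mult_mono) auto
    have pos: "f c d \<ge> 0" if "c < M" for c d
      using that by (auto simp: f_def)
    show ?thesis
    proof (cases "b \<le> a")
      case True
      then show ?thesis using le[of a b] pos[of b a] that by simp
    next
      case False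
      then show ?thesis using le[of b a] pos[of a b] that by (simp add: abs_if)
    qed
  qed
  have h: "(\<Sum>a<M. 1 / (real M - real a)) = (\<Sum>k<M. 1 / (real k + 1))"
    by (subst sum.nat_diff_reindex[symmetric]) (auto intro!: sum.cong simp: of_nat_diff)
  have f: "(\<Sum>b<M. \<Sum>a<M. f a b) = 4 * (\<Sum>k<M. 1 / (real k + 1))\<^sup>2"
  proof -
    have "(\<Sum>b<M. \<Sum>a<M. f a b) = (\<Sum>b<M. \<Sum>a<M. 4 * (1 / (real b + 1) * (1 / (real M - real a))))"
      by (intro sum.cong) (auto simp: f_def field_simps)
    also have "\<dots> = 4 * ((\<Sum>b<M. 1 / (real b + 1)) * (\<Sum>a<M. 1 / (real M - real a)))"
      unfolding sum_product unfolding sum_distrib_left ..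
    finally show ?thesis
      by (simp only: h power2_eq_square)
  qed
  have "(\<Sum>b<M. \<Sum>a<M. commutator_bound M a b)
      \<le> (\<Sum>b<M. \<Sum>a<M. 4 * pi\<^sup>2 / (real M)\<^sup>2 + (f a b + f b a))"
    unfolding commutator_bound_def using * by (intro sum_mono add_left_mono) auto
  also have "\<dots> = 4 * pi\<^sup>2 + ((\<Sum>b<M. \<Sum>a<M. f a b) + (\<Sum>b<M. \<Sum>a<M. f b a))"
    using M by (simp add: sum.distrib power2_eq_square)
  also have "(\<Sum>b<M. \<Sum>a<M. f b a) = (\<Sum>b<M. \<Sum>a<M. f a b)"
    by (rule sum.swap)
  also have "4 * pi\<^sup>2 + ((\<Sum>b<M. \<Sum>a<M. f a b) + (\<Sum>b<M. \<Sum>a<M. f a b))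
      \<le> 4 * pi\<^sup>2 + 8 * (real m + 1)\<^sup>2"
    unfolding f using harmonic_sum_le[of m]
    by (auto simp: M_def intro!: power_mono sum_nonneg)
  finally show ?thesis by (simp add: M_def)
qed

section \<open>Block readings\<close>

lemma bit_sum_of_bool:
  "bit (\<Sum>j<k. 2 ^ j * of_bool (P j) :: nat) i \<longleftrightarrow> i < k \<and> P i"
proof -
  have "(\<Sum>j<k. 2 ^ j * of_bool (P j) :: nat) = horner_sum of_bool 2 (map P [0..<k])"
    by (simp add: horner_sum_eq_sum mult.commute atLeast0LessThan)
  then show ?thesis
    by (auto simp: bit_horner_sum_bit_iff)
qed

lemma bit_out_reading: "bit (out_reading n a k s) i \<longleftrightarrow> i < k \<and> bit s (n - 1 - (a + i))"
  unfolding out_reading_def qubit_def bit_sum_of_bool diff_diff_left ..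

lemma bit_in_reading:
  assumes "a + k \<le> n"
  shows "bit (in_reading n a k s) i \<longleftrightarrow> i < k \<and> bit s (n - (a + k) + i)"
proof -
  have "in_reading n a k s = (\<Sum>i<k. 2 ^ i * of_bool (bit s (n - (a + k) + i)))"
    unfolding in_reading_def qubit_def
    by (subst sum.nat_diff_reindex[symmetric], intro sum.cong refl)
       (use assms in \<open>auto intro!: arg_cong2[of _ _ _ _ bit] simp: Suc_diff_Suc\<close>)
  then show ?thesis
    by (simp only: bit_sum_of_bool)
qed

lemma in_reading_eq:
  assumes "a + k \<le> n"
  shows "in_reading n a k s = s div 2 ^ (n - (a + k)) mod 2 ^ k"
proof -
  have "in_reading n a k s = take_bit k (drop_bit (n - (a + k)) s)"
    using assms by (auto simp: bit_eq_iff bit_in_reading bit_take_bit_iff bit_drop_bit_eq)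
  then show ?thesis
    by (simp add: take_bit_eq_mod drop_bit_eq_div)
qed

lemma out_reading_less: "out_reading n a k s < 2 ^ k"
proof -
  have "take_bit k (out_reading n a k s) = out_reading n a k s"
    by (auto simp: bit_eq_iff bit_take_bit_iff bit_out_reading)
  then show ?thesis
    by (metis take_bit_nat_less_exp)
qed

lemma out_reading_split:
  "out_reading n 0 (a + k) s = out_reading n 0 a s + 2 ^ a * out_reading n a k s"
proof -
  have "{..<a + k} = {..<a} \<union> {a..<a + k}" by auto
  then have "out_reading n 0 (a + k) s =
      out_reading n 0 a s + (\<Sum>j=0 + a..<k + a. 2 ^ j * qubit n s j)"
    by (simp add: out_reading_def sum.union_disjoint add.commute ivl_disj_int)
  also have "(\<Sum>j=0 + a..<k + a. 2 ^ j * qubit n s j) = 2 ^ a * out_reading n a k s"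
    unfolding sum.shift_bounds_nat_ivl
    by (simp add: out_reading_def sum_distrib_left power_add algebra_simps atLeast0LessThan)
  finally show ?thesis .
qed

text \<open>Turns the input reading of a block into its output reading, see
  \<open>out_reading_eq_bit_rev\<close>; from here on a single coordinate per block
  suffices.\<close>

definition bit_rev :: "nat \<Rightarrow> nat \<Rightarrow> nat" where
  "bit_rev k x = out_reading k 0 k x"

lemma bit_bit_rev: "bit (bit_rev k x) i \<longleftrightarrow> i < k \<and> bit x (k - 1 - i)"
  by (simp add: bit_rev_def bit_out_reading)

lemma bit_rev_less: "bit_rev k x < 2 ^ k"
  unfolding bit_rev_def by (rule out_reading_less)

lemma bij_betw_bit_rev: "bij_betw (bit_rev k) {..<2 ^ k} {..<2 ^ k}"
proof (rule bij_betw_byWitness[where f' = "bit_rev k"])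
  have "bit_rev k (bit_rev k x) = take_bit k x" for x
    by (auto simp: bit_eq_iff bit_bit_rev bit_take_bit_iff)
  then show "\<forall>x\<in>{..<2 ^ k}. bit_rev k (bit_rev k x) = x"
    "\<forall>x\<in>{..<2 ^ k}. bit_rev k (bit_rev k x) = x"
    by (auto simp: take_bit_nat_eq_self)
qed (auto simp: bit_rev_less)

lemma out_reading_eq_bit_rev:
  assumes "a + k \<le> n"
  shows "out_reading n a k s = bit_rev k (in_reading n a k s)"
proof -
  have "n - (a + k) + (k - 1 - i) = n - 1 - (a + i)" if "i < k" for i
    using assms that by simp
  then show ?thesis
    using assms by (auto simp: bit_eq_iff bit_bit_rev bit_out_reading bit_in_reading add.commute)
qed

lemma in_reading_eq_iff:
  assumes "a + k \<le> n"
  shows "in_reading n a k t = in_reading n a k s \<longleftrightarrow>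
    (\<forall>j\<in>{a..<a + k}. qubit n t j = qubit n s j)"
proof
  assume eq: "in_reading n a k t = in_reading n a k s"
  show "\<forall>j\<in>{a..<a + k}. qubit n t j = qubit n s j"
  proof
    fix j assume j: "j \<in> {a..<a + k}"
    then have "n - (a + k) + (k - 1 - (j - a)) = n - 1 - j" "k - 1 - (j - a) < k"
      using assms by auto
    then show "qubit n t j = qubit n s j"
      using bit_in_reading[OF assms, of t "k - 1 - (j - a)"]
        bit_in_reading[OF assms, of s "k - 1 - (j - a)"] eq
      by (simp add: qubit_def)
  qed
qed (auto simp: in_reading_def intro!: sum.cong)

lemma qubits_eq_imp_eq:
  assumes "\<forall>j<n. qubit n t j = qubit n s j" "s < 2 ^ n" "t < 2 ^ n"
  shows "t = s"
  using in_reading_eq_iff[of 0 n n t s] assms by (auto simp: in_reading_eq)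

text \<open>In binary, the fraction 0.s_a s_(a+1) ... is cut after its first \<open>k\<close>
  digits, and these digits form the input reading of the block.\<close>

lemma fraction_split:
  fixes s n a k :: nat
  assumes "a + k \<le> n"
  shows "real (s mod 2 ^ (n - a)) / 2 ^ (n - a) =
    real (in_reading n a k s) / 2 ^ k + real (s mod 2 ^ (n - (a + k))) / 2 ^ (n - (a + k)) / 2 ^ k"
proof -
  define q where "q = n - (a + k)"
  have na: "n - a = q + k" using assms by (simp add: q_def)
  have "s mod (2 ^ q * 2 ^ k) = 2 ^ q * (s div 2 ^ q mod 2 ^ k) + s mod 2 ^ q"
    by (rule mod_mult2_eq)
  then have "s mod 2 ^ (q + k) = 2 ^ q * in_reading n a k s + s mod 2 ^ q"
    by (simp only: in_reading_eq[OF assms] power_add flip: q_def)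
  then have "real (s mod 2 ^ (q + k)) = 2 ^ q * real (in_reading n a k s) + real (s mod 2 ^ q)"
    by (simp only: of_nat_add of_nat_mult of_nat_power of_nat_numeral)
  then show ?thesis
    unfolding na q_def[symmetric] by (simp add: power_add field_simps)
qed

section \<open>Unitary matrices and the Frobenius norm\<close>

lemma index_mat_adjoint:
  assumes "A \<in> carrier_mat d d" "i < d" "j < d"
  shows "mat_adjoint A $$ (i, j) = cnj (A $$ (j, i))"
  using assms by (simp add: mat_adjoint_def mat_of_rows_def)

lemma dim_mat_adjoint [simp]:
  "dim_row (mat_adjoint A) = dim_col A" "dim_col (mat_adjoint A) = dim_row A"
  by (auto simp: mat_adjoint_def)

lemma mat_adjoint_carrier [simp]: "(A :: complex mat) \<in> carrier_mat d d \<Longrightarrow> mat_adjoint A \<in> carrier_mat d d"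
  by (auto simp: mat_adjoint_def)

lemma mat_adjoint_mult:
  fixes A B :: "complex mat"
  assumes A: "A \<in> carrier_mat d d" and B: "B \<in> carrier_mat d d"
  shows "mat_adjoint (A * B) = mat_adjoint B * mat_adjoint A"
proof (rule eq_matI)
  fix i j assume "i < dim_row (mat_adjoint B * mat_adjoint A)" "j < dim_col (mat_adjoint B * mat_adjoint A)"
  with A B have ij: "i < d" "j < d" by auto
  show "mat_adjoint (A * B) $$ (i, j) = (mat_adjoint B * mat_adjoint A) $$ (i, j)"
    using ij A B mult_carrier_mat[OF A B]
    by (simp add: index_mat_adjoint[of _ d] scalar_prod_def mult.commute)
qed (use A B in auto)

lemma unitary_matD:
  assumes "unitary_mat d U"
  shows "U \<in> carrier_mat d d" "mat_adjoint U * U = 1\<^sub>m d" "U * mat_adjoint U = 1\<^sub>m d"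
  using assms by (auto simp: unitary_mat_def)

lemma mat_adjoint_adjoint: "(A :: complex mat) \<in> carrier_mat d d \<Longrightarrow> mat_adjoint (mat_adjoint A) = A"
proof (rule eq_matI)
  assume A: "A \<in> carrier_mat d d"
  note A' = mat_adjoint_carrier[OF A]
  show "mat_adjoint (mat_adjoint A) $$ (i, j) = A $$ (i, j)" if "i < dim_row A" "j < dim_col A" for i j
    using that A index_mat_adjoint[OF A', of i j] index_mat_adjoint[OF A, of j i] by auto
qed auto

lemma unitary_mat_adjoint: "unitary_mat d U \<Longrightarrow> unitary_mat d (mat_adjoint U)"
  by (auto simp: unitary_mat_def mat_adjoint_adjoint)

lemma unitary_mat_mult:
  assumes U: "unitary_mat d U" and V: "unitary_mat d V"
  shows "unitary_mat d (U * V)"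
proof -
  note c = unitary_matD(1)[OF U] unitary_matD(1)[OF V]
  have "mat_adjoint (U * V) * (U * V) = mat_adjoint V * (mat_adjoint U * U) * V"
    using c by (simp add: mat_adjoint_mult[of _ d] assoc_mult_mat[of _ d d _ d _ d] mult_carrier_mat[of _ d d _ d])
  moreover have "U * V * mat_adjoint (U * V) = U * (V * mat_adjoint V) * mat_adjoint U"
    using c by (simp add: mat_adjoint_mult[of _ d] assoc_mult_mat[of _ d d _ d _ d] mult_carrier_mat[of _ d d _ d])
  ultimately show ?thesis
    using c unitary_matD[OF U] unitary_matD[OF V]
    by (simp add: right_mult_one_mat[of _ d d] unitary_mat_def)
qed

lemma mult_square_carrier:
  "A \<in> carrier_mat d d \<Longrightarrow> C \<in> carrier_mat d d \<Longrightarrow> A * C \<in> carrier_mat d d"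
  by (rule mult_carrier_mat)

lemma index_mult_square:
  "A \<in> carrier_mat d d \<Longrightarrow> C \<in> carrier_mat d d \<Longrightarrow> i < d \<Longrightarrow> j < d \<Longrightarrow>
    (A * C) $$ (i, j) = (\<Sum>u<d. A $$ (i, u) * C $$ (u, j))"
  by (auto simp: scalar_prod_def atLeast0LessThan)

lemma frobenius_norm_sq:
  assumes "A \<in> carrier_mat d d"
  shows "(frobenius_norm A)\<^sup>2 = (\<Sum>s<d. \<Sum>t<d. (norm (A $$ (t, s)))\<^sup>2)"
proof -
  have "mat_trace (mat_adjoint A * A) = (\<Sum>s<d. \<Sum>t<d. cnj (A $$ (t, s)) * A $$ (t, s))"
    using assms mat_adjoint_carrier[OF assms]
    by (auto simp: mat_trace_def scalar_prod_def index_mat_adjoint[of _ d] atLeast0LessThan intro!: sum.cong)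
  also have "Re \<dots> = (\<Sum>s<d. \<Sum>t<d. (norm (A $$ (t, s)))\<^sup>2)"
    unfolding Re_sum cmod_power2 by (intro sum.cong refl) (simp add: power2_eq_square)
  finally show ?thesis
    by (simp add: frobenius_norm_def sum_nonneg)
qed

lemma frobenius_norm_unitary_mult:
  assumes "unitary_mat d U" "A \<in> carrier_mat d d"
  shows "frobenius_norm (U * A) = frobenius_norm A"
proof -
  note U = unitary_matD[OF assms(1)]
  have "mat_adjoint (U * A) * (U * A) = mat_adjoint A * (mat_adjoint U * U) * A"
    using U(1) assms(2) by (simp add: mat_adjoint_mult[of _ d] assoc_mult_mat[of _ d d _ d _ d] mult_carrier_mat[of _ d d _ d])
  then show ?thesis
    using U assms(2) by (simp add: right_mult_one_mat[of _ d d] frobenius_norm_def)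
qed

text \<open>Works entry by entry on squares, at the price of a factor 2 on each error term.\<close>

lemma frobenius_norm_triangle_sq:
  assumes "P \<in> carrier_mat d d" "Q \<in> carrier_mat d d" "R \<in> carrier_mat d d"
  shows "(frobenius_norm (P - R))\<^sup>2 \<le> 2 * (frobenius_norm (P - Q))\<^sup>2 + 2 * (frobenius_norm (Q - R))\<^sup>2"
proof -
  have c: "P - R \<in> carrier_mat d d" "P - Q \<in> carrier_mat d d" "Q - R \<in> carrier_mat d d"
    using assms by (auto intro: minus_carrier_mat)
  have "(norm (a + b))\<^sup>2 \<le> 2 * (norm a)\<^sup>2 + 2 * (norm b)\<^sup>2" for a b :: complex
  proof -
    have "(norm (a + b))\<^sup>2 \<le> (norm a + norm b)\<^sup>2"
      by (intro power_mono norm_triangle_ineq) simp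
    also have "\<dots> \<le> 2 * (norm a)\<^sup>2 + 2 * (norm b)\<^sup>2"
      using zero_le_power2[of "norm a - norm b"] by (simp add: power2_eq_square algebra_simps)
    finally show ?thesis .
  qed
  then have "(\<Sum>s<d. \<Sum>t<d. (norm ((P - R) $$ (t, s)))\<^sup>2) \<le>
      (\<Sum>s<d. \<Sum>t<d. 2 * (norm ((P - Q) $$ (t, s)))\<^sup>2 + 2 * (norm ((Q - R) $$ (t, s)))\<^sup>2)"
  proof (intro sum_mono)
    fix s t assume tri: "\<And>a b :: complex. (norm (a + b))\<^sup>2 \<le> 2 * (norm a)\<^sup>2 + 2 * (norm b)\<^sup>2"
      and "s \<in> {..<d}" "t \<in> {..<d}"
    then have "(P - R) $$ (t, s) = (P - Q) $$ (t, s) + (Q - R) $$ (t, s)" using assms by simp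
    then show "(norm ((P - R) $$ (t, s)))\<^sup>2 \<le>
        2 * (norm ((P - Q) $$ (t, s)))\<^sup>2 + 2 * (norm ((Q - R) $$ (t, s)))\<^sup>2"
      by (simp only: tri)
  qed
  then show ?thesis
    unfolding frobenius_norm_sq[OF c(1)] frobenius_norm_sq[OF c(2)] frobenius_norm_sq[OF c(3)]
    by (simp only: sum.distrib sum_distrib_left)
qed

lemma fold_mult_carrier:
  "set gs \<subseteq> carrier_mat d d \<Longrightarrow> U \<in> carrier_mat d d \<Longrightarrow>
    fold (\<lambda>G U. G * U) gs U \<in> carrier_mat d d"
  by (induction gs arbitrary: U) auto

lemma induced_mat_carrier: "set gs \<subseteq> carrier_mat d d \<Longrightarrow> induced_mat d gs \<in> carrier_mat d d"
  by (simp add: induced_mat_def fold_mult_carrier)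

lemma induced_mat_append:
  assumes "set xs \<subseteq> carrier_mat d d" "set ys \<subseteq> carrier_mat d d"
  shows "induced_mat d (xs @ ys) = induced_mat d ys * induced_mat d xs"
proof -
  have "fold (\<lambda>G U. G * U) ys U = induced_mat d ys * U" if "U \<in> carrier_mat d d" for U
    using assms(2) that
  proof (induction ys arbitrary: U rule: rev_induct)
    case (snoc y ys)
    then have c: "induced_mat d ys \<in> carrier_mat d d" by (intro induced_mat_carrier) auto
    have "fold (\<lambda>G U. G * U) (ys @ [y]) U = y * (induced_mat d ys * U)"
      using snoc by simp
    also have "\<dots> = (y * induced_mat d ys) * U"
      using snoc.prems c by (intro assoc_mult_mat[symmetric, of _ d d _ d _ d]) auto
    finally show ?case
      by (simp add: induced_mat_def)
  qed (simp add: induced_mat_def)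
  from this[OF induced_mat_carrier[OF assms(1)]] show ?thesis
    unfolding induced_mat_def by simp
qed

lemma induced_mat_snoc:
  "induced_mat d (xs @ [y]) = y * induced_mat d xs"
  by (simp add: induced_mat_def)

lemma induced_mat_diag:
  "distinct l \<Longrightarrow> induced_mat d (map (\<lambda>i. mat_diag d (f i)) l) = mat_diag d (\<lambda>s. \<Prod>i\<in>set l. f i s)"
  by (induction l rule: rev_induct) (simp_all add: induced_mat_snoc, simp_all add: induced_mat_def)

lemma unitary_mat_diag:
  assumes "\<And>s. s < d \<Longrightarrow> norm (f s) = 1"
  shows "unitary_mat d (mat_diag d f)"
proof -
  have "mat_adjoint (mat_diag d f) = mat_diag d (\<lambda>s. cnj (f s))"
  proof (rule eq_matI)
    fix i j assume "i < dim_row (mat_diag d (\<lambda>s. cnj (f s)))" "j < dim_col (mat_diag d (\<lambda>s. cnj (f s)))"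
    then have "i < d" "j < d" by (simp_all add: mat_diag_def)
    then show "mat_adjoint (mat_diag d f) $$ (i, j) = mat_diag d (\<lambda>s. cnj (f s)) $$ (i, j)"
      by (subst index_mat_adjoint[of _ d]) (auto simp: mat_diag_def)
  qed (auto simp: mat_diag_def)
  moreover have "cnj (f s) * f s = 1" "f s * cnj (f s) = 1" if "s < d" for s
    using assms[OF that] complex_norm_square[of "f s"] by (auto simp: mult.commute)
  ultimately show ?thesis
    by (auto simp: unitary_mat_def) (auto simp: mat_diag_def intro!: eq_matI)
qed

section \<open>Unitary kernels\<close>

text \<open>Kernels are plain functions, so that a tensor factor can be evaluated directly at block
  readings.\<close>

definition unitary_kernel :: "nat \<Rightarrow> (nat \<Rightarrow> nat \<Rightarrow> complex) \<Rightarrow> bool" where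
  "unitary_kernel N f \<longleftrightarrow> (\<forall>x<N. \<forall>y<N.
     (\<Sum>c<N. cnj (f c x) * f c y) = of_bool (x = y) \<and> (\<Sum>c<N. f x c * cnj (f y c)) = of_bool (x = y))"

text \<open>Both arguments are input readings. The row \<open>c\<close> enters through its bit
  reversal because the QFT writes its result in output reading.\<close>

definition qft_kernel :: "nat \<Rightarrow> nat \<Rightarrow> nat \<Rightarrow> complex" where
  "qft_kernel k c b = of_real (2 powr (- real k / 2)) * expi (real b * real (bit_rev k c) / 2 ^ k)"

lemma qft_scale_sq: "(2 powr (- real k / 2))\<^sup>2 = 1 / 2 ^ k"
proof -
  have "(2 powr (- real k / 2))\<^sup>2 = 2 powr (- real k)"
    unfolding power2_eq_square powr_add[symmetric] by simp
  also have "\<dots> = 1 / 2 ^ k"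
    by (simp add: powr_minus_divide powr_realpow)
  finally show ?thesis .
qed

lemma norm_qft_kernel_sq: "(norm (qft_kernel k c b))\<^sup>2 = 1 / 2 ^ k"
  using qft_scale_sq[of k] by (simp add: qft_kernel_def norm_mult power_mult_distrib)

lemma of_real_qft_scale_sq:
  "complex_of_real (2 powr (- real k / 2)) * complex_of_real (2 powr (- real k / 2)) = 1 / 2 ^ k"
  using arg_cong[OF qft_scale_sq[of k], of complex_of_real]
  by (simp add: power2_eq_square)

lemma expi_diff: "expi (x - y) = expi x * expi (- y)"
  using expi_add[of x "- y"] by simp

lemma cnj_qft_kernel_mult:
  "cnj (qft_kernel k c x) * qft_kernel k c y = 1 / 2 ^ k * expi (real (bit_rev k c) * (real y - real x) / 2 ^ k)"
proof -
  have "real (bit_rev k c) * (real y - real x) / 2 ^ k =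
      real y * real (bit_rev k c) / 2 ^ k - real x * real (bit_rev k c) / 2 ^ k"
    by (simp add: algebra_simps diff_divide_distrib)
  then show ?thesis
    by (simp add: qft_kernel_def expi_diff flip: of_real_qft_scale_sq)
qed

lemma qft_kernel_mult_cnj:
  "qft_kernel k x c * cnj (qft_kernel k y c) =
    1 / 2 ^ k * expi (real c * (real (bit_rev k x) - real (bit_rev k y)) / 2 ^ k)"
proof -
  have "real c * (real (bit_rev k x) - real (bit_rev k y)) / 2 ^ k =
      real c * real (bit_rev k x) / 2 ^ k - real c * real (bit_rev k y) / 2 ^ k"
    by (simp add: algebra_simps diff_divide_distrib)
  then show ?thesis
    by (simp add: qft_kernel_def expi_diff flip: of_real_qft_scale_sq)
qed

text \<open>A geometric sum over an \<open>M\<close>-th root of unity; |x - y| < M keeps this root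
  different from 1 unless \<open>x = y\<close>.\<close>

lemma sum_expi_multiples:
  fixes x y M :: nat
  assumes "x < M" "y < M"
  shows "(\<Sum>c<M. expi (real c * (real x - real y) / real M)) = of_bool (x = y) * of_nat M"
proof (cases "x = y")
  case False
  define u where "u = (real x - real y) / real M"
  have "expi (real M * u) = 1"
  proof -
    have "real M * u = real x - real y" using assms by (simp add: u_def)
    then have "expi (real M * u) * expi (real y) = expi (real x)"
      unfolding expi_add[symmetric] by simp
    then show ?thesis by (simp only: expi_of_nat mult_1_right)
  qed
  then have 0: "(\<Sum>c<M. expi (real c * u)) * (1 - expi u) = 0"
    using one_diff_power_eq[of "expi u" M] by (simp add: expi_power mult.commute)
  have "expi u \<noteq> 1"
  proof
    assume "expi u = 1"
    then have "sin (pi * u) = 0" using norm_expi_diff[of u 0] by simp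
    then obtain i where "pi * u = of_int i * pi" by (auto simp: sin_zero_iff_int2)
    then have "u = of_int i" by simp
    then have "real x - real y = of_int (i * int M)" using assms by (simp add: u_def field_simps)
    then have "int x - int y = i * int M" by linarith
    moreover have "\<bar>int x - int y\<bar> < int M" using assms by linarith
    ultimately have "\<bar>i\<bar> * int M < 1 * int M" by (simp add: abs_mult)
    then have "i = 0" by (simp only: mult_less_cancel_right) auto
    with \<open>int x - int y = i * int M\<close> False show False by simp
  qed
  with 0 False show ?thesis by (simp add: u_def)
qed simp

lemma unitary_qft_kernel: "unitary_kernel (2 ^ k) (qft_kernel k)"
  unfolding unitary_kernel_def
proof (intro allI impI conjI)
  fix x y :: nat assume xy: "x < 2 ^ k" "y < 2 ^ k"
  have "(\<Sum>c<2 ^ k. cnj (qft_kernel k c x) * qft_kernel k c y) =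
      1 / 2 ^ k *
      (\<Sum>c<2 ^ k. expi (real (bit_rev k c) * (real y - real x) / 2 ^ k))"
    unfolding cnj_qft_kernel_mult qft_kernel_mult_cnj sum_distrib_left ..
  also have "(\<Sum>c<2 ^ k. expi (real (bit_rev k c) * (real y - real x) / 2 ^ k)) =
      (\<Sum>c<2 ^ k. expi (real c * (real y - real x) / 2 ^ k))"
    by (rule sum.reindex_bij_betw[OF bij_betw_bit_rev])
  also have "\<dots> = of_bool (x = y) * 2 ^ k"
    using sum_expi_multiples[OF xy(2,1)] by auto
  finally show "(\<Sum>c<2 ^ k. cnj (qft_kernel k c x) * qft_kernel k c y) = of_bool (x = y)"
    by simp
  have "(\<Sum>c<2 ^ k. qft_kernel k x c * cnj (qft_kernel k y c)) =
      1 / 2 ^ k *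
      (\<Sum>c<2 ^ k. expi (real c * (real (bit_rev k x) - real (bit_rev k y)) / 2 ^ k))"
    unfolding cnj_qft_kernel_mult qft_kernel_mult_cnj sum_distrib_left ..
  also have "\<dots> = of_bool (bit_rev k x = bit_rev k y)"
    using sum_expi_multiples[OF bit_rev_less[of k x] bit_rev_less[of k y]] by simp
  also have "\<dots> = of_bool (x = y)"
    using bij_betw_imp_inj_on[OF bij_betw_bit_rev[of k]] xy by (auto dest: inj_onD)
  finally show "(\<Sum>c<2 ^ k. qft_kernel k x c * cnj (qft_kernel k y c)) = of_bool (x = y)" .
qed

text \<open>The adjoint of a unitary preserves lengths: after expanding the squares, summing over
  \<open>a\<close> first leaves the orthogonality of the rows.\<close>

lemma unitary_kernel_parseval:
  assumes "unitary_kernel N f"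
  shows "(\<Sum>a<N. (norm (\<Sum>c<N. cnj (f c a) * v c))\<^sup>2) = (\<Sum>c<N. (norm (v c))\<^sup>2)"
proof -
  have "complex_of_real (\<Sum>a<N. (norm (\<Sum>c<N. cnj (f c a) * v c))\<^sup>2) =
      (\<Sum>a<N. \<Sum>c<N. \<Sum>c'<N. (cnj (f c a) * v c) * cnj (cnj (f c' a) * v c'))"
    by (simp only: of_real_sum complex_norm_square cnj_sum sum_product)
  also have "\<dots> = (\<Sum>c<N. \<Sum>c'<N. \<Sum>a<N. (cnj (f c a) * v c) * cnj (cnj (f c' a) * v c'))"
    by (subst sum.swap) (intro sum.cong refl sum.swap)
  also have "\<dots> = (\<Sum>c<N. \<Sum>c'<N. (v c * cnj (v c')) * (\<Sum>a<N. f c' a * cnj (f c a)))"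
    by (simp add: sum_distrib_left mult_ac)
  also have "\<dots> = (\<Sum>c<N. \<Sum>c'<N. (v c * cnj (v c')) * of_bool (c' = c))"
    using assms by (intro sum.cong refl) (auto simp: unitary_kernel_def)
  also have "\<dots> = (\<Sum>c<N. v c * cnj (v c))"
    by (simp add: of_bool_def if_distrib[of "\<lambda>x. _ * x"] cong: if_cong)
  also have "\<dots> = complex_of_real (\<Sum>c<N. (norm (v c))\<^sup>2)"
    by (simp only: of_real_sum complex_norm_square)
  finally show ?thesis
    by (simp only: of_real_eq_iff)
qed

definition delta :: "nat \<Rightarrow> nat \<Rightarrow> complex" where
  "delta x y = of_bool (x = y)"

lemma unitary_kernel_delta: "unitary_kernel N delta"
  by (auto simp: unitary_kernel_def delta_def of_bool_def if_distrib[of "\<lambda>x. x * _"]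
      if_distrib[of cnj] if_distrib[of "\<lambda>x. _ * x"] cong: if_cong)

lemma sum_delta_left:
  "y < N \<Longrightarrow> (\<Sum>c<N. delta y c * f c) = f y"
  by (simp add: delta_def of_bool_def if_distrib[of "\<lambda>x. x * _"] cong: if_cong)

lemma sum_delta_right:
  "y < N \<Longrightarrow> (\<Sum>c<N. f c * delta c y) = f y"
  by (simp add: delta_def of_bool_def if_distrib[of "\<lambda>x. _ * x"] cong: if_cong)

definition on_blocks :: "nat set \<Rightarrow> (nat \<Rightarrow> nat \<Rightarrow> nat \<Rightarrow> complex) \<Rightarrow> nat \<Rightarrow> nat \<Rightarrow> nat \<Rightarrow> complex" where
  "on_blocks I f j = (if j \<in> I then f j else delta)"

lemma unitary_kernel_on_blocks:
  "(j \<in> I \<Longrightarrow> unitary_kernel N (f j)) \<Longrightarrow> unitary_kernel N (on_blocks I f j)"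
  by (simp add: on_blocks_def unitary_kernel_delta)

lemma prod_delta:
  "finite A \<Longrightarrow> (\<Prod>j\<in>A. delta (f j) (g j)) = of_bool (\<forall>j\<in>A. f j = g j)"
  by (induction A rule: finite_induct) (auto simp: delta_def)

section \<open>Tensor products over the blocks\<close>

text \<open>The block size may exceed \<open>n\<close>; then a single block holds all qubits. The
  size chosen at the end is never compared with \<open>n\<close>.\<close>

locale block_split =
  fixes n m :: nat
  assumes n: "1 \<le> n" and m: "1 \<le> m"
begin

abbreviation B where "B \<equiv> num_blocks n m"
abbreviation sz where "sz \<equiv> block_size n m"
abbreviation X where "X i s \<equiv> in_reading n (block_start m i) (sz i) s"

lemma num_blocks_bounds: "0 < B" "(B - 1) * m < n" "n \<le> B * m" "B \<le> n"
proof -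
  have pos: "0 < real n / real m" using n m by simp
  then show B: "0 < B" unfolding num_blocks_def by simp
  have "real B = of_int \<lceil>real n / real m\<rceil>"
    using pos unfolding num_blocks_def by (subst of_nat_nat) auto
  then have "real n / real m \<le> real B" "real B - 1 < real n / real m"
    by linarith+
  then have le: "real n \<le> real B * real m" and less: "(real B - 1) * real m < real n"
    using m by (simp_all add: field_simps)
  show "n \<le> B * m" using le by (simp flip: of_nat_mult)
  show l: "(B - 1) * m < n" using less B by (simp flip: of_nat_mult add: of_nat_diff) (metis One_nat_def Suc_leI of_nat_1 of_nat_diff of_nat_less_iff of_nat_mult)
  have "(B - 1) * 1 \<le> (B - 1) * m" using m by (intro mult_le_mono) auto
  with l show "B \<le> n" by linarith
qed

lemma block_size_inner [simp]: "i < B - 1 \<Longrightarrow> sz i = m"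
  by (simp add: block_size_def)

lemma block_end:
  assumes "i < B"
  shows "block_start m i + sz i = (if Suc i < B then block_start m (Suc i) else n)"
proof (cases "Suc i < B")
  case False
  then have "i = B - 1" using assms by simp
  with num_blocks_bounds(2) False show ?thesis
    by (simp add: block_size_def block_start_def)
next
  case True
  then have "i < B - 1" by simp
  with True show ?thesis by (simp add: block_start_def)
qed

lemma block_end_le:
  assumes "i < B"
  shows "block_start m i + sz i \<le> n"
proof (cases "Suc i < B")
  case True
  then have "Suc i * m \<le> (B - 1) * m" by (intro mult_le_mono) auto
  then show ?thesis using block_end[OF assms] num_blocks_bounds True by (simp add: block_start_def)
qed (simp add: block_end assms)

lemma block_cover:
  assumes "j < n"
  shows "\<exists>i<B. j \<in> {block_start m i..<block_start m i + sz i}"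
proof -
  have "j < B * m" using assms num_blocks_bounds by simp
  then have i: "j div m < B" using m by (simp add: div_less_iff_less_mult)
  have "j div m * m \<le> j" by simp
  moreover have "j < Suc (j div m) * m" using m
    by (metis dividend_less_div_times mult_Suc add.commute less_eq_Suc_le One_nat_def)
  ultimately have "j \<in> {block_start m (j div m)..<block_start m (j div m) + sz (j div m)}"
    unfolding block_end[OF i] using assms by (auto simp: block_start_def)
  with i show ?thesis by blast
qed

lemma block_disjoint:
  assumes "i < B" "i' < B" "j \<in> {block_start m i..<block_start m i + sz i}"
    "j \<in> {block_start m i'..<block_start m i' + sz i'}"
  shows "i = i'"
proof -
  have "\<not> a < b" if "a < B" "b < B" "j < block_start m a + sz a" "block_start m b \<le> j" for a b
  proof
    assume "a < b"
    then have "Suc a * m \<le> b * m" by (intro mult_le_mono) auto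
    then show False using that block_end[OF that(1)] \<open>a < b\<close> by (auto simp: block_start_def split: if_splits)
  qed
  from this[of i i'] this[of i' i] assms show ?thesis by (auto simp: not_less)
qed

lemma sum_block_sizes: "(\<Sum>i<B. sz i) = n"
proof -
  have "(\<Sum>i<k. sz i) = (if k < B then block_start m k else n)" if "0 < k" "k \<le> B" for k
    using that
  proof (induction k)
    case (Suc k)
    then show ?case
      using block_end[of k] by (cases "k = 0") (auto simp: block_start_def)
  qed simp
  from this[of B] num_blocks_bounds(1) show ?thesis by simp
qed

lemma reading_less: "i < B \<Longrightarrow> X i s < 2 ^ sz i"
  by (simp add: in_reading_eq block_end_le)

text \<open>Turns the qubitwise condition of \<open>QFT_on\<close> into one on block readings, which
  is a product of \<open>delta\<close> factors.\<close>

lemma agree_outside_iff: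
  assumes "i < B"
  shows "(\<forall>j<n. j \<notin> {block_start m i..<block_start m i + sz i} \<longrightarrow> qubit n t j = qubit n s j) \<longleftrightarrow>
    (\<forall>i'<B. i' \<noteq> i \<longrightarrow> X i' t = X i' s)" (is "?L \<longleftrightarrow> ?R")
proof
  assume L: ?L
  show ?R
  proof (intro allI impI)
    fix i' assume i': "i' < B" "i' \<noteq> i"
    show "X i' t = X i' s"
      unfolding in_reading_eq_iff[OF block_end_le[OF i'(1)]]
    proof
      fix j assume j: "j \<in> {block_start m i'..<block_start m i' + sz i'}"
      then have "j \<notin> {block_start m i..<block_start m i + sz i}"
        using block_disjoint[OF i'(1) assms] i' by blast
      moreover have "j < n" using j block_end_le[OF i'(1)] by simp
      ultimately show "qubit n t j = qubit n s j" using L by blast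
    qed
  qed
next
  assume R: ?R
  show ?L
  proof (intro allI impI)
    fix j assume j: "j < n" "j \<notin> {block_start m i..<block_start m i + sz i}"
    obtain i' where i': "i' < B" "j \<in> {block_start m i'..<block_start m i' + sz i'}"
      using block_cover[OF j(1)] by blast
    then have "X i' t = X i' s" using R j by blast
    then show "qubit n t j = qubit n s j"
      using i' in_reading_eq_iff[OF block_end_le[OF i'(1)]] by blast
  qed
qed

lemma readings_eqD:
  assumes "\<forall>i<B. X i t = X i s" "s < 2 ^ n" "t < 2 ^ n"
  shows "t = s"
proof (rule qubits_eq_imp_eq)
  show "\<forall>j<n. qubit n t j = qubit n s j"
  proof (intro allI impI)
    fix j assume "j < n"
    from block_cover[OF this] obtain i where
      i: "i < B" "j \<in> {block_start m i..<block_start m i + sz i}" by blast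
    with assms(1) in_reading_eq_iff[OF block_end_le[OF i(1)]] show "qubit n t j = qubit n s j"
      by blast
  qed
qed (use assms in auto)

text \<open>Sending an index to the tuple of its block readings is injective into a product set with
  2 ^ n elements, hence bijective; the rest is distributivity. Matrix products, marginals and
  averages over inputs are all derived from this identity.\<close>

lemma sum_prod_readings:
  fixes f :: "nat \<Rightarrow> nat \<Rightarrow> 'a::comm_semiring_1"
  shows "(\<Sum>u<2 ^ n. \<Prod>j<B. f j (X j u)) = (\<Prod>j<B. \<Sum>c<2 ^ sz j. f j c)"
proof -
  define \<xi> where "\<xi> u = (\<lambda>j\<in>{..<B}. X j u)" for u
  let ?P = "PiE {..<B} (\<lambda>j. {..<(2::nat) ^ sz j})"
  have inj: "inj_on \<xi> {..<2 ^ n}"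
  proof (rule inj_onI)
    fix u v assume uv: "u \<in> {..<2 ^ n}" "v \<in> {..<2 ^ n}" "\<xi> u = \<xi> v"
    have "X i u = X i v" if "i < B" for i
      using fun_cong[OF uv(3), of i] that by (simp add: \<xi>_def)
    with uv readings_eqD[of u v] show "u = v" by simp
  qed
  have "card ?P = 2 ^ n"
    by (simp add: card_PiE sum_block_sizes power_sum[symmetric])
  moreover have sub: "\<xi> ` {..<2 ^ n} \<subseteq> ?P"
  proof
    fix g assume "g \<in> \<xi> ` {..<2 ^ n}"
    then obtain u where "g = \<xi> u" by blast
    then show "g \<in> ?P" unfolding \<xi>_def restrict_PiE_iff by (auto simp: reading_less)
  qed
  moreover have "finite ?P"
    by (intro finite_PiE) auto
  ultimately have img: "\<xi> ` {..<2 ^ n} = ?P"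
    using card_image[OF inj] by (intro card_subset_eq) auto
  have "(\<Sum>u<2 ^ n. \<Prod>j<B. f j (X j u)) = (\<Sum>u<2 ^ n. \<Prod>j<B. f j (\<xi> u j))"
    by (simp add: \<xi>_def)
  also have "\<dots> = (\<Sum>g\<in>?P. \<Prod>j<B. f j (g j))"
    using sum.reindex[OF inj, of "\<lambda>g. \<Prod>j<B. f j (g j)"] img by simp
  also have "\<dots> = (\<Prod>j<B. \<Sum>c<2 ^ sz j. f j c)"
    by (rule prod_sum_PiE[symmetric]) auto
  finally show ?thesis .
qed

definition tensor :: "(nat \<Rightarrow> nat \<Rightarrow> nat \<Rightarrow> complex) \<Rightarrow> complex mat" where
  "tensor f = mat (2 ^ n) (2 ^ n) (\<lambda>(t, s). \<Prod>j<B. f j (X j t) (X j s))"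

lemma tensor_carrier [simp]: "tensor f \<in> carrier_mat (2 ^ n) (2 ^ n)"
  by (simp add: tensor_def)

lemma index_tensor:
  "t < 2 ^ n \<Longrightarrow> s < 2 ^ n \<Longrightarrow> tensor f $$ (t, s) = (\<Prod>j<B. f j (X j t) (X j s))"
  by (simp add: tensor_def)

lemma tensor_cong:
  assumes "\<And>j x y. j < B \<Longrightarrow> x < 2 ^ sz j \<Longrightarrow> y < 2 ^ sz j \<Longrightarrow> f j x y = g j x y"
  shows "tensor f = tensor g"
  unfolding tensor_def by (intro cong_mat) (auto intro!: prod.cong assms reading_less)

lemma tensor_mult:
  "tensor f * tensor g = tensor (\<lambda>j x y. \<Sum>c<2 ^ sz j. f j x c * g j c y)"
proof (rule eq_matI)
  fix t s assume "t < dim_row (tensor (\<lambda>j x y. \<Sum>c<2 ^ sz j. f j x c * g j c y))"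
    "s < dim_col (tensor (\<lambda>j x y. \<Sum>c<2 ^ sz j. f j x c * g j c y))"
  then have ts: "t < 2 ^ n" "s < 2 ^ n" by (simp_all add: tensor_def)
  have "(tensor f * tensor g) $$ (t, s) =
      (\<Sum>u<2 ^ n. \<Prod>j<B. f j (X j t) (X j u) * g j (X j u) (X j s))"
    using ts by (simp add: tensor_def scalar_prod_def atLeast0LessThan prod.distrib)
  also have "\<dots> = (\<Prod>j<B. \<Sum>c<2 ^ sz j. f j (X j t) c * g j c (X j s))"
    by (rule sum_prod_readings)
  finally show "(tensor f * tensor g) $$ (t, s) =
      tensor (\<lambda>j x y. \<Sum>c<2 ^ sz j. f j x c * g j c y) $$ (t, s)"
    using ts by (simp add: index_tensor)
qed (simp_all add: tensor_def)

lemma tensor_adjoint: "mat_adjoint (tensor f) = tensor (\<lambda>j x y. cnj (f j y x))"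
proof (rule eq_matI)
  fix t s assume "t < dim_row (tensor (\<lambda>j x y. cnj (f j y x)))" "s < dim_col (tensor (\<lambda>j x y. cnj (f j y x)))"
  then have ts: "t < 2 ^ n" "s < 2 ^ n" by (simp_all add: tensor_def)
  then show "mat_adjoint (tensor f) $$ (t, s) = tensor (\<lambda>j x y. cnj (f j y x)) $$ (t, s)"
    by (simp add: index_mat_adjoint[of _ "2 ^ n"] index_tensor)
qed (simp_all add: tensor_def)

lemma tensor_delta: "tensor (\<lambda>_. delta) = 1\<^sub>m (2 ^ n)"
proof (rule eq_matI)
  fix t s assume "t < dim_row (1\<^sub>m (2 ^ n) :: complex mat)" "s < dim_col (1\<^sub>m (2 ^ n) :: complex mat)"
  then have ts: "t < 2 ^ n" "s < 2 ^ n" by simp_all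
  then show "tensor (\<lambda>_. delta) $$ (t, s) = 1\<^sub>m (2 ^ n) $$ (t, s)"
    using readings_eqD[of t s] by (auto simp: index_tensor prod_delta)
qed (simp_all add: tensor_def)

lemma unitary_tensor:
  assumes "\<And>j. j < B \<Longrightarrow> unitary_kernel (2 ^ sz j) (f j)"
  shows "unitary_mat (2 ^ n) (tensor f)"
proof -
  have "mat_adjoint (tensor f) * tensor f = tensor (\<lambda>_. delta)"
    unfolding tensor_adjoint tensor_mult
    using assms by (intro tensor_cong) (simp add: unitary_kernel_def delta_def)
  moreover have "tensor f * mat_adjoint (tensor f) = tensor (\<lambda>_. delta)"
    unfolding tensor_adjoint tensor_mult
    using assms by (intro tensor_cong) (simp add: unitary_kernel_def delta_def)
  ultimately show ?thesis
    by (simp add: unitary_mat_def tensor_delta)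
qed

lemma induced_mat_on_blocks:
  assumes "distinct l" "set l \<subseteq> {..<B}"
  shows "induced_mat (2 ^ n) (map (\<lambda>i. tensor (on_blocks {i} f)) l) = tensor (on_blocks (set l) f)"
  using assms
proof (induction l rule: rev_induct)
  case Nil
  then show ?case
    using tensor_delta by (simp add: induced_mat_def on_blocks_def[abs_def])
next
  case (snoc i l)
  then have "induced_mat (2 ^ n) (map (\<lambda>i. tensor (on_blocks {i} f)) (l @ [i])) =
      tensor (on_blocks {i} f) * tensor (on_blocks (set l) f)"
    by (simp add: induced_mat_snoc)
  also have "\<dots> = tensor (on_blocks (set (l @ [i])) f)"
    unfolding tensor_mult using snoc.prems
    by (intro tensor_cong) (auto simp: on_blocks_def sum_delta_left sum_delta_right)
  finally show ?case .
qed

abbreviation w where "w \<equiv> \<lambda>j. qft_kernel (sz j)"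

lemma QFT_on_entry:
  assumes "a + k \<le> n" "t < 2 ^ n" "s < 2 ^ n"
  shows "QFT_on n a k $$ (t, s) =
    (if \<forall>j<n. j \<notin> {a..<a + k} \<longrightarrow> qubit n t j = qubit n s j
     then qft_kernel k (in_reading n a k t) (in_reading n a k s) else 0)"
  using assms unfolding QFT_on_def qft_kernel_def exp_eq_expi
  by (simp only: index_mat case_prod_conv out_reading_eq_bit_rev)

lemma block_QFT_eq_tensor:
  assumes i: "i < B"
  shows "block_QFT n m i = tensor (on_blocks {i} w)"
proof (rule eq_matI)
  fix t s assume "t < dim_row (tensor (on_blocks {i} w))" "s < dim_col (tensor (on_blocks {i} w))"
  then have ts: "t < 2 ^ n" "s < 2 ^ n" by (simp_all add: tensor_def)
  have "tensor (on_blocks {i} w) $$ (t, s) =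
      w i (X i t) (X i s) * (\<Prod>j\<in>{..<B} - {i}. delta (X j t) (X j s))"
    using ts i by (subst index_tensor, simp, simp, subst prod.remove[of _ i])
      (auto simp: on_blocks_def intro!: prod.cong)
  also have "\<dots> = block_QFT n m i $$ (t, s)"
    unfolding block_QFT_def QFT_on_entry[OF block_end_le[OF i] ts] agree_outside_iff[OF i]
    by (auto simp: prod_delta)
  finally show "block_QFT n m i $$ (t, s) = tensor (on_blocks {i} w) $$ (t, s)" ..
qed (simp_all add: tensor_def block_QFT_def QFT_on_def)

text \<open>\<open>c\<close> is the input reading of block \<open>i\<close>, whose output reading
  enters the phase, and \<open>b\<close> is the input reading of block \<open>i + 1\<close>.\<close>

definition phase :: "nat \<Rightarrow> nat \<Rightarrow> nat \<Rightarrow> complex" where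
  "phase i c b = expi (real b * real (bit_rev (sz i) c) / 2 ^ (sz i + sz (Suc i)))"

lemma phase_rotation_eq:
  assumes "i < B - 1"
  shows "phase_rotation n m i = mat_diag (2 ^ n) (\<lambda>s. phase i (X i s) (X (Suc i) s))"
proof -
  have "i < B" using assms by simp
  then show ?thesis
    unfolding phase_rotation_def
    by (simp only: exp_eq_expi phase_def out_reading_eq_bit_rev block_end_le Suc_eq_plus1)
qed

section \<open>Error of the optimistic circuit against the nearest-neighbour QFT\<close>

definition evens where "evens = {i. i < B \<and> even i}"
definition odds where "odds = {i. i < B \<and> odd i}"
definition even_pairs where "even_pairs = {i. i < B - 1 \<and> even i}"
definition odd_pairs where "odd_pairs = {i. i < B - 1 \<and> odd i}"

definition QFT_even where "QFT_even = tensor (on_blocks evens w)"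
definition QFT_odd where "QFT_odd = tensor (on_blocks odds w)"

text \<open>The left block of a pair is read in \<open>t\<close>, the right one in \<open>s\<close>.
  For \<open>t = s\<close> this is the diagonal of the rotation gates; for a row \<open>t\<close>
  and a column \<open>s\<close> it is the phase in the exact QFT, where the output of a block meets
  the input of the next.\<close>

definition pair_phase :: "nat set \<Rightarrow> nat \<Rightarrow> nat \<Rightarrow> complex" where
  "pair_phase I t s = (\<Prod>i\<in>I. phase i (X i t) (X (Suc i) s))"

definition pair_phase_mat where
  "pair_phase_mat I = mat_diag (2 ^ n) (\<lambda>s. pair_phase I s s)"

lemma finite_pairs [simp]: "finite even_pairs" "finite odd_pairs"
  by (simp_all add: even_pairs_def odd_pairs_def)

lemma norm_phase [simp]: "norm (phase i c b) = 1"
  by (simp add: phase_def)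

lemma norm_pair_phase [simp]: "norm (pair_phase I t s) = 1"
  by (simp add: pair_phase_def flip: prod_norm)

lemma pair_phase_mat_carrier [simp]: "pair_phase_mat I \<in> carrier_mat (2 ^ n) (2 ^ n)"
  by (simp add: pair_phase_mat_def)

lemma QFT_even_carrier [simp]: "QFT_even \<in> carrier_mat (2 ^ n) (2 ^ n)"
  and QFT_odd_carrier [simp]: "QFT_odd \<in> carrier_mat (2 ^ n) (2 ^ n)"
  by (simp_all add: QFT_even_def QFT_odd_def)

lemma unitary_QFT_even: "unitary_mat (2 ^ n) QFT_even"
  and unitary_QFT_odd: "unitary_mat (2 ^ n) QFT_odd"
  unfolding QFT_even_def QFT_odd_def
  by (intro unitary_tensor unitary_kernel_on_blocks unitary_qft_kernel)+

lemma unitary_pair_phase_mat: "unitary_mat (2 ^ n) (pair_phase_mat I)"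
  unfolding pair_phase_mat_def by (rule unitary_mat_diag) simp

text \<open>The circuit induces \<open>QFT_even * pair_phase_mat odd_pairs * conjugated\<close>. Since
  \<open>QFT_even * conjugated = one_sided\<close>, multiplying by \<open>QFT_even\<close> from the left reduces the comparison
  with the truncated QFT to an entrywise one: the phases of the odd pairs are evaluated at the new
  instead of the old reading of the even block.\<close>

definition one_sided where "one_sided = QFT_odd * (pair_phase_mat even_pairs * QFT_even)"
definition conjugated where "conjugated = mat_adjoint QFT_even * one_sided"

lemma one_sided_carrier [simp]: "one_sided \<in> carrier_mat (2 ^ n) (2 ^ n)"
  and conjugated_carrier [simp]: "conjugated \<in> carrier_mat (2 ^ n) (2 ^ n)"
  unfolding one_sided_def conjugated_def
  by (intro mult_square_carrier mat_adjoint_carrier QFT_even_carrier QFT_odd_carrier pair_phase_mat_carrier)+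

lemma unitary_circuit:
  "unitary_mat (2 ^ n) (QFT_even * (pair_phase_mat odd_pairs * conjugated))"
  unfolding conjugated_def one_sided_def
  by (intro unitary_mat_mult unitary_QFT_even unitary_QFT_odd unitary_pair_phase_mat unitary_mat_adjoint)

lemma induced_block_QFTs:
  assumes "distinct l" "set l \<subseteq> {..<B}"
  shows "induced_mat (2 ^ n) (map (block_QFT n m) l) = tensor (on_blocks (set l) w)"
    "set (map (block_QFT n m) l) \<subseteq> carrier_mat (2 ^ n) (2 ^ n)"
proof -
  have eq: "map (block_QFT n m) l = map (\<lambda>i. tensor (on_blocks {i} w)) l"
    using assms by (auto simp: block_QFT_eq_tensor)
  show "induced_mat (2 ^ n) (map (block_QFT n m) l) = tensor (on_blocks (set l) w)"
    unfolding eq by (rule induced_mat_on_blocks[OF assms])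
  show "set (map (block_QFT n m) l) \<subseteq> carrier_mat (2 ^ n) (2 ^ n)"
    unfolding eq by auto
qed

lemma on_blocks_adjoint:
  "mat_adjoint (tensor (on_blocks I f)) = tensor (on_blocks I (\<lambda>j x y. cnj (f j y x)))"
  unfolding tensor_adjoint by (intro tensor_cong) (auto simp: on_blocks_def delta_def)

lemma induced_adjoint_block_QFTs:
  assumes "distinct l" "set l \<subseteq> {..<B}"
  shows "induced_mat (2 ^ n) (map (\<lambda>i. mat_adjoint (block_QFT n m i)) l) =
      mat_adjoint (tensor (on_blocks (set l) w))"
    "set (map (\<lambda>i. mat_adjoint (block_QFT n m i)) l) \<subseteq> carrier_mat (2 ^ n) (2 ^ n)"
proof -
  have eq: "map (\<lambda>i. mat_adjoint (block_QFT n m i)) l =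
      map (\<lambda>i. tensor (on_blocks {i} (\<lambda>j x y. cnj (w j y x)))) l"
    using assms by (auto simp: block_QFT_eq_tensor on_blocks_adjoint)
  show "induced_mat (2 ^ n) (map (\<lambda>i. mat_adjoint (block_QFT n m i)) l) =
      mat_adjoint (tensor (on_blocks (set l) w))"
    unfolding eq on_blocks_adjoint by (rule induced_mat_on_blocks[OF assms])
  show "set (map (\<lambda>i. mat_adjoint (block_QFT n m i)) l) \<subseteq> carrier_mat (2 ^ n) (2 ^ n)"
    unfolding eq by auto
qed

lemma induced_phase_rotations:
  assumes "distinct l" "set l \<subseteq> {..<B - 1}"
  shows "induced_mat (2 ^ n) (map (phase_rotation n m) l) = pair_phase_mat (set l)"
    "set (map (phase_rotation n m) l) \<subseteq> carrier_mat (2 ^ n) (2 ^ n)"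
proof -
  have eq: "map (phase_rotation n m) l =
      map (\<lambda>i. mat_diag (2 ^ n) (\<lambda>s. phase i (X i s) (X (Suc i) s))) l"
    using assms by (auto simp: phase_rotation_eq)
  show "induced_mat (2 ^ n) (map (phase_rotation n m) l) = pair_phase_mat (set l)"
    unfolding eq pair_phase_mat_def pair_phase_def by (rule induced_mat_diag[OF assms(1)])
  show "set (map (phase_rotation n m) l) \<subseteq> carrier_mat (2 ^ n) (2 ^ n)"
    unfolding eq by auto
qed

lemma induced_optimistic_QFT:
  "induced_mat (2 ^ n) (optimistic_QFT n m) =
    QFT_even * (pair_phase_mat odd_pairs * conjugated)"
proof -
  have l: "set (filter even [0..<B]) = evens" "set (filter odd [0..<B]) = odds"
    "set (filter even [0..<B - 1]) = even_pairs" "set (filter odd [0..<B - 1]) = odd_pairs"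
    by (auto simp: evens_def odds_def even_pairs_def odd_pairs_def)
  have fE: "distinct (filter even [0..<B])" "set (filter even [0..<B]) \<subseteq> {..<B}"
    and fO: "distinct (filter odd [0..<B])" "set (filter odd [0..<B]) \<subseteq> {..<B}"
    and pE: "distinct (filter even [0..<B - 1])" "set (filter even [0..<B - 1]) \<subseteq> {..<B - 1}"
    and pO: "distinct (filter odd [0..<B - 1])" "set (filter odd [0..<B - 1]) \<subseteq> {..<B - 1}"
    by auto
  have "induced_mat (2 ^ n) (optimistic_QFT n m) =
      QFT_even * pair_phase_mat odd_pairs * mat_adjoint QFT_even * QFT_odd *
      pair_phase_mat even_pairs * QFT_even"
    unfolding optimistic_QFT_def Let_def
    by (simp only: induced_mat_append set_append Un_subset_iff simp_thms
        induced_block_QFTs[OF fE] induced_block_QFTs[OF fO] induced_adjoint_block_QFTs[OF fE]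
        induced_phase_rotations[OF pE] induced_phase_rotations[OF pO] l
        flip: QFT_even_def QFT_odd_def)
  also have "\<dots> = QFT_even * (pair_phase_mat odd_pairs * conjugated)"
    unfolding conjugated_def one_sided_def
    by (simp add: assoc_mult_mat[of _ "2 ^ n" "2 ^ n" _ "2 ^ n" _ "2 ^ n"] mult_square_carrier)
  finally show ?thesis .
qed

text \<open>Allows a phase that depends only on untouched blocks to leave a sum over intermediate
  basis states.\<close>

lemma on_blocks_nonzeroD:
  assumes "tensor (on_blocks I f) $$ (t, u) \<noteq> 0" "t < 2 ^ n" "u < 2 ^ n" "j < B" "j \<notin> I"
  shows "X j t = X j u"
proof (rule ccontr)
  assume "X j t \<noteq> X j u"
  then have "on_blocks I f j (X j t) (X j u) = 0"
    using assms by (simp add: on_blocks_def delta_def)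
  then have "(\<Prod>j<B. on_blocks I f j (X j t) (X j u)) = 0"
    using assms(4) by (intro prod_zero) auto
  with assms show False by (simp add: index_tensor)
qed

text \<open>In an even pair \<open>QFT_odd\<close> fixes the left block and \<open>QFT_even\<close>
  the right one. Every contributing intermediate state thus has its left reading from the row and
  its right reading from the column, so the even pairs are treated without error.\<close>

lemma one_sided_entry:
  assumes ts: "t < 2 ^ n" "s < 2 ^ n"
  shows "one_sided $$ (t, s) = pair_phase even_pairs t s * (\<Prod>j<B. w j (X j t) (X j s))"
proof -
  have move: "QFT_odd $$ (t, u) * (pair_phase even_pairs u u * QFT_even $$ (u, s)) =
      pair_phase even_pairs t s * (QFT_odd $$ (t, u) * QFT_even $$ (u, s))" if u: "u < 2 ^ n" for u
  proof (cases "QFT_odd $$ (t, u) = 0 \<or> QFT_even $$ (u, s) = 0")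
    case False
    then have nz: "QFT_odd $$ (t, u) \<noteq> 0" "QFT_even $$ (u, s) \<noteq> 0" by auto
    have "X i u = X i t \<and> X (Suc i) u = X (Suc i) s" if "i \<in> even_pairs" for i
      using that on_blocks_nonzeroD[OF nz(1)[unfolded QFT_odd_def] ts(1) u, of i]
        on_blocks_nonzeroD[OF nz(2)[unfolded QFT_even_def] u ts(2), of "Suc i"]
      by (auto simp: even_pairs_def odds_def evens_def)
    then have "pair_phase even_pairs u u = pair_phase even_pairs t s"
      unfolding pair_phase_def by (intro prod.cong) auto
    then show ?thesis by simp
  qed auto
  have "one_sided $$ (t, s) =
      (\<Sum>u<2 ^ n. QFT_odd $$ (t, u) * (pair_phase_mat even_pairs * QFT_even) $$ (u, s))"
    unfolding one_sided_def by (rule index_mult_square) (use ts in \<open>auto intro: mult_square_carrier\<close>)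
  also have "\<dots> = (\<Sum>u<2 ^ n. QFT_odd $$ (t, u) * (pair_phase even_pairs u u * QFT_even $$ (u, s)))"
    using ts by (simp add: pair_phase_mat_def mat_diag_mult_left[OF QFT_even_carrier])
  also have "\<dots> = (\<Sum>u<2 ^ n. pair_phase even_pairs t s * (QFT_odd $$ (t, u) * QFT_even $$ (u, s)))"
    by (intro sum.cong refl move) auto
  also have "\<dots> = pair_phase even_pairs t s * (\<Sum>u<2 ^ n. QFT_odd $$ (t, u) * QFT_even $$ (u, s))"
    by (simp only: sum_distrib_left)
  also have "(\<Sum>u<2 ^ n. QFT_odd $$ (t, u) * QFT_even $$ (u, s)) = (QFT_odd * QFT_even) $$ (t, s)"
    by (rule index_mult_square[symmetric]) (use ts in auto)
  also have "QFT_odd * QFT_even = tensor w"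
    unfolding QFT_odd_def QFT_even_def tensor_mult
    by (intro tensor_cong) (auto simp: on_blocks_def odds_def evens_def sum_delta_left sum_delta_right)
  finally show ?thesis
    using ts by (simp add: index_tensor)
qed

section \<open>Columns of the conjugated operator as product states\<close>

definition block_amp :: "nat \<Rightarrow> nat \<Rightarrow> nat \<Rightarrow> complex" where
  "block_amp s j c = (if j \<in> even_pairs then phase j c (X (Suc j) s) else 1) * w j c (X j s)"

text \<open>\<open>conj_amp s j\<close> is the column \<open>X j s\<close> of the operator on block \<open>j\<close>: for even \<open>j\<close> with a right
  neighbour this is the QFT conjugate of the phase towards that neighbour, for odd \<open>j\<close> it is the QFT.\<close>

definition conj_amp :: "nat \<Rightarrow> nat \<Rightarrow> nat \<Rightarrow> complex" where
  "conj_amp s j a =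
    (\<Sum>c<2 ^ sz j. on_blocks evens (\<lambda>j x y. cnj (w j y x)) j a c * block_amp s j c)"

text \<open>Once the column \<open>s\<close> is fixed, the phase on an even block sees its right
  neighbour only through the constant \<open>X (Suc j) s\<close>. Nothing couples the blocks any
  more, and the sum over the register factors.\<close>

lemma conjugated_entry:
  assumes ts: "t < 2 ^ n" "s < 2 ^ n"
  shows "conjugated $$ (t, s) = (\<Prod>j<B. conj_amp s j (X j t))"
proof -
  have sub: "{..<B} \<inter> even_pairs = even_pairs"
    by (auto simp: even_pairs_def)
  have one: "one_sided $$ (u, s) = (\<Prod>j<B. block_amp s j (X j u))" if "u < 2 ^ n" for u
    using one_sided_entry[OF that ts(2)]
    by (simp add: block_amp_def prod.distrib pair_phase_def prod.inter_restrict[symmetric] sub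
        flip: prod.inter_restrict)
  have "conjugated $$ (t, s) = (\<Sum>u<2 ^ n. mat_adjoint QFT_even $$ (t, u) * one_sided $$ (u, s))"
    unfolding conjugated_def by (rule index_mult_square) (use ts in auto)
  also have "\<dots> = (\<Sum>u<2 ^ n. \<Prod>j<B. on_blocks evens (\<lambda>j x y. cnj (w j y x)) j (X j t) (X j u) *
      block_amp s j (X j u))"
    using ts by (intro sum.cong) (auto simp: one QFT_even_def on_blocks_adjoint index_tensor prod.distrib)
  also have "\<dots> = (\<Prod>j<B. conj_amp s j (X j t))"
    unfolding conj_amp_def by (rule sum_prod_readings)
  finally show ?thesis .
qed

lemma sum_norm_conj_amp:
  assumes "j < B"
  shows "(\<Sum>a<2 ^ sz j. (norm (conj_amp s j a))\<^sup>2) = 1"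
proof -
  have "(\<Sum>a<2 ^ sz j. (norm (conj_amp s j a))\<^sup>2) = (\<Sum>c<2 ^ sz j. (norm (block_amp s j c))\<^sup>2)"
  proof (cases "j \<in> evens")
    case True
    then show ?thesis
      using unitary_kernel_parseval[OF unitary_qft_kernel]
      by (simp add: conj_amp_def on_blocks_def)
  next
    case False
    then show ?thesis
      by (intro sum.cong) (auto simp: conj_amp_def on_blocks_def sum_delta_left)
  qed
  also have "\<dots> = (\<Sum>c<(2::nat) ^ sz j. 1 / 2 ^ sz j)"
    by (intro sum.cong) (auto simp: block_amp_def norm_mult power_mult_distrib norm_qft_kernel_sq)
  finally show ?thesis by simp
qed

text \<open>The squared moduli of a column form a product of probability distributions, so the
  blocks other than \<open>j\<close> sum to 1.\<close>

lemma marginal_conjugated: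
  fixes h :: "nat \<Rightarrow> real"
  assumes s: "s < 2 ^ n" and j: "j < B"
  shows "(\<Sum>x<2 ^ n. h (X j x) * (norm (conjugated $$ (x, s)))\<^sup>2) =
    (\<Sum>a<2 ^ sz j. h a * (norm (conj_amp s j a))\<^sup>2)"
proof -
  define f where "f k a = (if k = j then h a else 1) * (norm (conj_amp s k a))\<^sup>2" for k a
  have "(\<Sum>x<2 ^ n. h (X j x) * (norm (conjugated $$ (x, s)))\<^sup>2) = (\<Sum>x<2 ^ n. \<Prod>k<B. f k (X k x))"
    using s j by (intro sum.cong)
      (auto simp: conjugated_entry f_def prod.distrib prod.delta prod_power_distrib simp flip: prod_norm)
  also have "\<dots> = (\<Prod>k<B. \<Sum>a<2 ^ sz k. f k a)"
    by (rule sum_prod_readings)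
  also have "\<dots> = (\<Sum>a<2 ^ sz j. f j a) * (\<Prod>k\<in>{..<B} - {j}. \<Sum>a<2 ^ sz k. f k a)"
    using j by (intro prod.remove) auto
  also have "(\<Prod>k\<in>{..<B} - {j}. \<Sum>a<2 ^ sz k. f k a) = 1"
    by (intro prod.neutral) (auto simp: f_def sum_norm_conj_amp)
  finally show ?thesis by (simp add: f_def)
qed

lemma sum_reading:
  fixes g :: "nat \<Rightarrow> real"
  assumes j: "j < B"
  shows "(\<Sum>s<2 ^ n. g (X j s)) = 2 ^ n / 2 ^ sz j * (\<Sum>b<2 ^ sz j. g b)"
proof -
  define f where "f k a = (if k = j then g a else 1)" for k a
  have "(\<Sum>s<2 ^ n. g (X j s)) = (\<Sum>s<2 ^ n. \<Prod>k<B. f k (X k s))"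
    using j by (simp add: f_def prod.delta)
  also have "\<dots> = (\<Prod>k<B. \<Sum>a<2 ^ sz k. f k a)"
    by (rule sum_prod_readings)
  also have "\<dots> = (\<Sum>a<2 ^ sz j. f j a) * (\<Prod>k\<in>{..<B} - {j}. \<Sum>a<2 ^ sz k. f k a)"
    using j by (intro prod.remove) auto
  also have "(\<Prod>k\<in>{..<B} - {j}. \<Sum>a<2 ^ sz k. f k a) = (\<Prod>k\<in>{..<B} - {j}. 2 ^ sz k)"
    by (intro prod.cong) (auto simp: f_def)
  also have "\<dots> = 2 ^ n / 2 ^ sz j"
  proof -
    have "(2::real) ^ n = (\<Prod>k<B. 2 ^ sz k)"
      by (simp add: sum_block_sizes power_sum[symmetric])
    also have "\<dots> = 2 ^ sz j * (\<Prod>k\<in>{..<B} - {j}. 2 ^ sz k)"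
      using j by (intro prod.remove) auto
    finally show ?thesis by simp
  qed
  finally show ?thesis by (simp add: f_def)
qed

lemma norm_phase_diff_le: "norm (phase i c b - phase i c b') \<le> phase_gap (2 ^ sz (Suc i)) b b'"
proof -
  have "norm (phase i c b - phase i c b') \<le> 2"
    using norm_triangle_ineq4[of "phase i c b" "phase i c b'"] by simp
  moreover have "norm (phase i c b - phase i c b') \<le> 2 * pi * \<bar>real b - real b'\<bar> / 2 ^ sz (Suc i)"
  proof -
    have "real b * real (bit_rev (sz i) c) / 2 ^ (sz i + sz (Suc i)) -
        real b' * real (bit_rev (sz i) c) / 2 ^ (sz i + sz (Suc i)) =
        (real b - real b') / 2 ^ sz (Suc i) * (real (bit_rev (sz i) c) / 2 ^ sz i)"
      by (simp add: power_add field_simps)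
    then have "norm (phase i c b - phase i c b') \<le>
        2 * pi * \<bar>(real b - real b') / 2 ^ sz (Suc i) * (real (bit_rev (sz i) c) / 2 ^ sz i)\<bar>"
      unfolding phase_def by (metis norm_expi_diff_le)
    also have "\<dots> = 2 * pi * (\<bar>real b - real b'\<bar> / 2 ^ sz (Suc i) * (real (bit_rev (sz i) c) / 2 ^ sz i))"
      by (simp add: abs_mult)
    also have "\<dots> \<le> 2 * pi * (\<bar>real b - real b'\<bar> / 2 ^ sz (Suc i) * 1)"
      using bit_rev_less[of "sz i" c]
      by (intro mult_left_mono) (auto simp: less_imp_le simp flip: of_nat_less_iff)
    finally show ?thesis by simp
  qed
  ultimately show ?thesis by (simp add: phase_gap_def)
qed

text \<open>The neighbour phase is a character in the output reading, so conjugating it by the QFT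
  gives a translation of the input reading, here by \<open>X (Suc j) s / 2 ^ sz (Suc j)\<close>.
  This fraction is the \<theta> of \<open>dirichlet_kernel_le\<close>.\<close>

lemma conj_amp_inner:
  assumes j: "j \<in> even_pairs"
  shows "conj_amp s j a =
    (\<Sum>y<2 ^ m. expi (real y * ((real (X j s) - real a + X (Suc j) s / 2 ^ sz (Suc j)) / 2 ^ m))) / 2 ^ m"
proof -
  have [simp]: "sz j = m" "j \<in> evens"
    using j by (auto simp: even_pairs_def evens_def)
  define \<theta> where "\<theta> = X (Suc j) s / 2 ^ sz (Suc j)"
  have "conj_amp s j a = (\<Sum>c<2 ^ m. phase j c (X (Suc j) s) * (cnj (w j c a) * w j c (X j s)))"
    using j unfolding conj_amp_def by (intro sum.cong) (auto simp: on_blocks_def block_amp_def)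
  also have "\<dots> = (\<Sum>c<2 ^ m. expi (real (bit_rev m c) * ((real (X j s) - real a + \<theta>) / 2 ^ m)) / 2 ^ m)"
  proof (rule sum.cong[OF refl])
    fix c assume "c \<in> {..<(2::nat) ^ m}"
    have "real (bit_rev m c) * ((real (X j s) - real a + \<theta>) / 2 ^ m) =
        real (X (Suc j) s) * real (bit_rev m c) / 2 ^ (m + sz (Suc j)) +
        real (bit_rev m c) * (real (X j s) - real a) / 2 ^ m"
      by (simp add: \<theta>_def power_add field_simps)
    then show "phase j c (X (Suc j) s) * (cnj (w j c a) * w j c (X j s)) =
        expi (real (bit_rev m c) * ((real (X j s) - real a + \<theta>) / 2 ^ m)) / 2 ^ m"
      by (simp add: cnj_qft_kernel_mult phase_def expi_add)
  qed
  \<comment> \<open>Summing over output readings instead of input readings makes the sum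
    geometric.\<close>
  also have "\<dots> = (\<Sum>y<2 ^ m. expi (real y * ((real (X j s) - real a + \<theta>) / 2 ^ m)) / 2 ^ m)"
    by (rule sum.reindex_bij_betw[OF bij_betw_bit_rev])
  finally show ?thesis
    by (simp add: \<theta>_def sum_divide_distrib)
qed

text \<open>If the last block has even index, no phase lies between its QFT and the inverse. The
  round trip is then the identity, and the gap vanishes on the diagonal.\<close>

lemma gap_conj_amp_le:
  assumes s: "s < 2 ^ n" and j: "j \<in> evens" "a < 2 ^ sz j"
  shows "(phase_gap (2 ^ sz j) a (X j s))\<^sup>2 * (norm (conj_amp s j a))\<^sup>2
    \<le> (if j \<in> even_pairs then commutator_bound (2 ^ m) a (X j s) else 0)"
proof (cases "j \<in> even_pairs")
  case True
  then have sz: "sz j = m" "Suc j < B" by (auto simp: even_pairs_def)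
  have "X j s < 2 ^ m" using reading_less[of j s] j sz by (auto simp: evens_def)
  moreover have "real (X (Suc j) s) / 2 ^ sz (Suc j) < 1"
    using reading_less[OF sz(2), of s] by (simp flip: of_nat_less_iff)
  ultimately show ?thesis
    using phase_gap_dirichlet_le[of a "2 ^ m" "X j s" "X (Suc j) s / 2 ^ sz (Suc j)"] j True
    by (simp add: sz conj_amp_inner norm_divide norm_power)
next
  case False
  have "conj_amp s j a = of_bool (a = X j s)"
    using unitary_qft_kernel[of "sz j"] j reading_less[of j s] False
    by (simp add: conj_amp_def on_blocks_def block_amp_def unitary_kernel_def evens_def)
  then show ?thesis
    using False by (simp add: phase_gap_def)
qed

text \<open>The average over inputs enters here: each reading of block \<open>j\<close> occurs for 2
  ^ n / 2 ^ m inputs \<open>s\<close>. For a single input near the ends of the range the inner sum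
  can be of constant order.\<close>

lemma sum_gap_conjugated_le:
  assumes j: "j \<in> evens"
  shows "(\<Sum>s<2 ^ n. \<Sum>x<2 ^ n. (phase_gap (2 ^ sz j) (X j x) (X j s))\<^sup>2 * (norm (conjugated $$ (x, s)))\<^sup>2)
    \<le> 2 ^ n / 2 ^ m * (4 * pi\<^sup>2 + 8 * (real m + 1)\<^sup>2)"
proof (cases "j \<in> even_pairs")
  case True
  then have jB: "j < B" "sz j = m" by (auto simp: even_pairs_def)
  have "(\<Sum>s<2 ^ n. \<Sum>x<2 ^ n. (phase_gap (2 ^ sz j) (X j x) (X j s))\<^sup>2 * (norm (conjugated $$ (x, s)))\<^sup>2)
      \<le> (\<Sum>s<2 ^ n. \<Sum>a<2 ^ m. commutator_bound (2 ^ m) a (X j s))"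
    using gap_conj_amp_le[OF _ j] True jB
    by (intro sum_mono, subst marginal_conjugated) (auto intro!: sum_mono)
  also have "\<dots> = 2 ^ n / 2 ^ m * (\<Sum>b<2 ^ m. \<Sum>a<2 ^ m. commutator_bound (2 ^ m) a b)"
    using sum_reading[OF jB(1), of "\<lambda>b. \<Sum>a<2 ^ m. commutator_bound (2 ^ m) a b"] jB by simp
  also have "\<dots> \<le> 2 ^ n / 2 ^ m * (4 * pi\<^sup>2 + 8 * (real m + 1)\<^sup>2)"
    by (intro mult_left_mono sum_commutator_bound_le) simp
  finally show ?thesis .
next
  case False
  have jB: "j < B" using j by (simp add: evens_def)
  have "(\<Sum>s<2 ^ n. \<Sum>x<2 ^ n. (phase_gap (2 ^ sz j) (X j x) (X j s))\<^sup>2 * (norm (conjugated $$ (x, s)))\<^sup>2)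
      \<le> (\<Sum>s<(2::nat) ^ n. 0)"
    using gap_conj_amp_le[OF _ j] False jB
    by (intro sum_mono, subst marginal_conjugated) (auto intro!: sum_nonpos)
  also have "\<dots> \<le> 2 ^ n / 2 ^ m * (4 * pi\<^sup>2 + 8 * (real m + 1)\<^sup>2)"
    by simp
  finally show ?thesis .
qed

section \<open>The odd phases and the last QFT layer\<close>

definition approx_QFT where
  "approx_QFT = mat (2 ^ n) (2 ^ n) (\<lambda>(t, s). pair_phase odd_pairs t s * one_sided $$ (t, s))"

lemma approx_QFT_carrier [simp]: "approx_QFT \<in> carrier_mat (2 ^ n) (2 ^ n)"
  by (simp add: approx_QFT_def)

definition phased_conjugated where
  "phased_conjugated = mat (2 ^ n) (2 ^ n) (\<lambda>(x, s). pair_phase odd_pairs x s * conjugated $$ (x, s))"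

lemma phased_conjugated_carrier [simp]: "phased_conjugated \<in> carrier_mat (2 ^ n) (2 ^ n)"
  by (simp add: phased_conjugated_def)

text \<open>The phases of the odd pairs can be pulled through \<open>QFT_even\<close> because they depend on the row
  index only through the odd blocks, which \<open>QFT_even\<close> fixes.\<close>

lemma approx_QFT_eq: "approx_QFT = QFT_even * phased_conjugated"
proof (rule eq_matI)
  fix t s assume "t < dim_row (QFT_even * phased_conjugated)" "s < dim_col (QFT_even * phased_conjugated)"
  then have ts: "t < 2 ^ n" "s < 2 ^ n"
    using QFT_even_carrier by (auto simp: phased_conjugated_def)
  have move: "QFT_even $$ (t, x) * (pair_phase odd_pairs x s * conjugated $$ (x, s)) =
      pair_phase odd_pairs t s * (QFT_even $$ (t, x) * conjugated $$ (x, s))" if x: "x < 2 ^ n" for x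
  proof (cases "QFT_even $$ (t, x) = 0")
    case False
    have "X i x = X i t" if "i \<in> odd_pairs" for i
      using that on_blocks_nonzeroD[OF False[unfolded QFT_even_def] ts(1) x, of i]
      by (auto simp: odd_pairs_def evens_def)
    then have "pair_phase odd_pairs x s = pair_phase odd_pairs t s"
      unfolding pair_phase_def by (intro prod.cong) auto
    then show ?thesis by simp
  qed simp
  have "(QFT_even * phased_conjugated) $$ (t, s) =
      (\<Sum>x<2 ^ n. QFT_even $$ (t, x) * phased_conjugated $$ (x, s))"
    by (rule index_mult_square) (use ts in auto)
  also have "\<dots> = (\<Sum>x<2 ^ n. QFT_even $$ (t, x) * (pair_phase odd_pairs x s * conjugated $$ (x, s)))"
    using ts by (simp add: phased_conjugated_def)
  also have "\<dots> = (\<Sum>x<2 ^ n. pair_phase odd_pairs t s * (QFT_even $$ (t, x) * conjugated $$ (x, s)))"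
    by (intro sum.cong refl move) auto
  also have "\<dots> = pair_phase odd_pairs t s * (\<Sum>x<2 ^ n. QFT_even $$ (t, x) * conjugated $$ (x, s))"
    by (simp only: sum_distrib_left)
  also have "(\<Sum>x<2 ^ n. QFT_even $$ (t, x) * conjugated $$ (x, s)) = (QFT_even * conjugated) $$ (t, s)"
    by (rule index_mult_square[symmetric]) (use ts in auto)
  also have "QFT_even * conjugated = (QFT_even * mat_adjoint QFT_even) * one_sided"
    unfolding conjugated_def using QFT_even_carrier one_sided_carrier
    by (intro assoc_mult_mat[symmetric, of _ "2 ^ n" "2 ^ n" _ "2 ^ n" _ "2 ^ n"]) auto
  also have "\<dots> = one_sided"
    by (simp only: unitary_matD(3)[OF unitary_QFT_even] left_mult_one_mat[OF one_sided_carrier])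
  finally show "approx_QFT $$ (t, s) = (QFT_even * phased_conjugated) $$ (t, s)"
    using ts by (simp add: approx_QFT_def)
qed (auto simp: approx_QFT_def phased_conjugated_def QFT_even_def tensor_def)

text \<open>A product of unit numbers changes by at most the sum of the changes of its factors;
  Cauchy-Schwarz over at most \<open>n\<close> pairs then costs the first factor
  \<open>n\<close>.\<close>

lemma norm_pair_phase_diff_le:
  "(norm (pair_phase odd_pairs x x - pair_phase odd_pairs x s))\<^sup>2
    \<le> real n * (\<Sum>i\<in>odd_pairs. (phase_gap (2 ^ sz (Suc i)) (X (Suc i) x) (X (Suc i) s))\<^sup>2)"
proof -
  let ?d = "\<lambda>i. norm (phase i (X i x) (X (Suc i) x) - phase i (X i x) (X (Suc i) s))"
  have "odd_pairs \<subseteq> {..<B}" by (auto simp: odd_pairs_def)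
  then have card: "card odd_pairs \<le> n"
    using card_mono[of "{..<B}" odd_pairs] num_blocks_bounds by simp
  have "norm (pair_phase odd_pairs x x - pair_phase odd_pairs x s) \<le> (\<Sum>i\<in>odd_pairs. ?d i)"
    unfolding pair_phase_def by (rule norm_prod_diff) simp_all
  then have "(norm (pair_phase odd_pairs x x - pair_phase odd_pairs x s))\<^sup>2 \<le> (\<Sum>i\<in>odd_pairs. ?d i)\<^sup>2"
    by (intro power_mono) auto
  also have "\<dots> \<le> (\<Sum>i\<in>odd_pairs. (?d i)\<^sup>2) * card odd_pairs"
    by (rule sum_squared_le_sum_of_squares)
  also have "\<dots> \<le> (\<Sum>i\<in>odd_pairs. (phase_gap (2 ^ sz (Suc i)) (X (Suc i) x) (X (Suc i) s))\<^sup>2) * n"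
    using card by (intro mult_mono sum_mono power_mono norm_phase_diff_le) (auto intro: sum_nonneg)
  finally show ?thesis by (simp add: mult.commute)
qed

text \<open>The common left factor \<open>QFT_even\<close> preserves the norm, which leaves the
  phase differences weighted by the entries of \<open>conjugated\<close>. Summing over the pairs
  costs the second factor \<open>n\<close>.\<close>

lemma frobenius_circuit_approx_le:
  "(frobenius_norm (QFT_even * (pair_phase_mat odd_pairs * conjugated) - approx_QFT))\<^sup>2
    \<le> (real n)\<^sup>2 * (2 ^ n / 2 ^ m * (4 * pi\<^sup>2 + 8 * (real m + 1)\<^sup>2))"
proof -
  let ?D = "pair_phase_mat odd_pairs * conjugated - phased_conjugated"
  let ?K = "2 ^ n / 2 ^ m * (4 * pi\<^sup>2 + 8 * (real m + 1)\<^sup>2)"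
  have c: "pair_phase_mat odd_pairs * conjugated \<in> carrier_mat (2 ^ n) (2 ^ n)"
    by (intro mult_square_carrier) auto
  have D: "?D \<in> carrier_mat (2 ^ n) (2 ^ n)"
    using c by (intro minus_carrier_mat) auto
  have entry: "?D $$ (x, s) = (pair_phase odd_pairs x x - pair_phase odd_pairs x s) * conjugated $$ (x, s)"
    if "x < 2 ^ n" "s < 2 ^ n" for x s
    using that
    by (simp add: pair_phase_mat_def mat_diag_mult_left[OF conjugated_carrier] phased_conjugated_def algebra_simps)
  have "QFT_even * (pair_phase_mat odd_pairs * conjugated) - approx_QFT = QFT_even * ?D"
    unfolding approx_QFT_eq using c
    by (intro mult_minus_distrib_mat[symmetric, of _ "2 ^ n" "2 ^ n" _ "2 ^ n"]) auto
  then have "(frobenius_norm (QFT_even * (pair_phase_mat odd_pairs * conjugated) - approx_QFT))\<^sup>2 =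
      (frobenius_norm ?D)\<^sup>2"
    using frobenius_norm_unitary_mult[OF unitary_QFT_even D] by simp
  also have "\<dots> = (\<Sum>s<2 ^ n. \<Sum>x<2 ^ n. (norm (pair_phase odd_pairs x x - pair_phase odd_pairs x s))\<^sup>2 *
      (norm (conjugated $$ (x, s)))\<^sup>2)"
    unfolding frobenius_norm_sq[OF D]
    by (intro sum.cong refl) (simp add: entry norm_mult power_mult_distrib del: index_minus_mat)
  also have "\<dots> \<le> (\<Sum>s<2 ^ n. \<Sum>x<2 ^ n. (real n * (\<Sum>i\<in>odd_pairs.
      (phase_gap (2 ^ sz (Suc i)) (X (Suc i) x) (X (Suc i) s))\<^sup>2)) * (norm (conjugated $$ (x, s)))\<^sup>2)"
    by (intro sum_mono mult_right_mono norm_pair_phase_diff_le) simp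
  also have "\<dots> = real n * (\<Sum>s<2 ^ n. \<Sum>x<2 ^ n. \<Sum>i\<in>odd_pairs.
      (phase_gap (2 ^ sz (Suc i)) (X (Suc i) x) (X (Suc i) s))\<^sup>2 * (norm (conjugated $$ (x, s)))\<^sup>2)"
    by (simp only: sum_distrib_left sum_distrib_right mult.assoc)
  also have "(\<Sum>s<2 ^ n. \<Sum>x<2 ^ n. \<Sum>i\<in>odd_pairs.
      (phase_gap (2 ^ sz (Suc i)) (X (Suc i) x) (X (Suc i) s))\<^sup>2 * (norm (conjugated $$ (x, s)))\<^sup>2) =
      (\<Sum>i\<in>odd_pairs. \<Sum>s<2 ^ n. \<Sum>x<2 ^ n.
      (phase_gap (2 ^ sz (Suc i)) (X (Suc i) x) (X (Suc i) s))\<^sup>2 * (norm (conjugated $$ (x, s)))\<^sup>2)"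
    by (rule trans[OF sum.cong[OF refl sum.swap] sum.swap])
  also have "\<dots> \<le> (\<Sum>i\<in>odd_pairs. ?K)"
    by (intro sum_mono sum_gap_conjugated_le) (auto simp: odd_pairs_def evens_def)
  also have "\<dots> \<le> real n * ?K"
  proof -
    have "odd_pairs \<subseteq> {..<B}" by (auto simp: odd_pairs_def)
    then have "card odd_pairs \<le> n"
      using card_mono[of "{..<B}" odd_pairs] num_blocks_bounds by simp
    then have "real (card odd_pairs) * ?K \<le> real n * ?K"
      by (intro mult_right_mono) auto
    then show ?thesis by (simp only: sum_constant)
  qed
  finally show ?thesis
    by (simp add: power2_eq_square mult.assoc mult_left_mono)
qed

section \<open>Error of the nearest-neighbour QFT\<close>

lemma sum_block_sizes_lessThan: "k < B \<Longrightarrow> (\<Sum>i<k. sz i) = block_start m k"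
proof (induction k)
  case (Suc k)
  then show ?case using block_end[of k] by simp
qed (simp add: block_start_def)

definition Y where "Y i t = bit_rev (sz i) (X i t)"

lemma out_reading_blocks:
  "k \<le> B \<Longrightarrow> out_reading n 0 (\<Sum>i<k. sz i) t = (\<Sum>i<k. 2 ^ block_start m i * Y i t)"
proof (induction k)
  case 0
  then show ?case by (simp add: out_reading_def)
next
  case (Suc k)
  then have "k < B" by simp
  with Suc show ?case
    by (simp only: sum.lessThan_Suc out_reading_split sum_block_sizes_lessThan Y_def
        out_reading_eq_bit_rev block_end_le less_imp_le)
qed

text \<open>The binary fraction 0.s_p s_(p+1) ... formed by the qubits from \<open>p\<close> on; it
  is 0 for \<open>p = n\<close>.\<close>

definition tail_frac where
  "tail_frac p s = real (s mod 2 ^ (n - p)) / 2 ^ (n - p)"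

lemma tail_frac_bounds: "0 \<le> tail_frac p s" "tail_frac p s \<le> 1"
proof -
  have "s mod 2 ^ (n - p) \<le> 2 ^ (n - p)"
    by (rule less_imp_le) simp
  then have "real (s mod 2 ^ (n - p)) \<le> real (2 ^ (n - p))"
    unfolding of_nat_le_iff .
  then show "tail_frac p s \<le> 1" by (simp add: tail_frac_def)
qed (simp add: tail_frac_def)

text \<open>The phase, in full turns, between the output of block \<open>i\<close> and all qubits
  beyond block \<open>i + 1\<close>: exactly what the truncation drops.\<close>

definition far_phase :: "nat \<Rightarrow> nat \<Rightarrow> nat \<Rightarrow> real" where
  "far_phase t s i = real (Y i t) / 2 ^ sz i *
    (tail_frac (block_start m (Suc i) + sz (Suc i)) s / 2 ^ sz (Suc i))"

lemma far_phase_bounds: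
  assumes "i < B - 1"
  shows "0 \<le> far_phase t s i" "far_phase t s i \<le> 1 / 2 ^ m"
proof -
  let ?f = "tail_frac (block_start m (Suc i) + sz (Suc i)) s"
  have y: "0 \<le> real (Y i t) / 2 ^ sz i" "real (Y i t) / 2 ^ sz i \<le> 1"
  proof -
    have "real (Y i t) \<le> real (2 ^ sz i)"
      unfolding of_nat_le_iff Y_def using bit_rev_less by (rule less_imp_le)
    then show "real (Y i t) / 2 ^ sz i \<le> 1" by simp
  qed simp
  show "0 \<le> far_phase t s i"
    unfolding far_phase_def using tail_frac_bounds y by (intro mult_nonneg_nonneg) auto
  have "?f / 2 ^ sz (Suc i) \<le> 1 / 2 ^ m"
  proof (cases "Suc i < B - 1")
    case True
    then show ?thesis using tail_frac_bounds by (simp add: divide_right_mono)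
  next
    \<comment> \<open>The last block can be shorter than \<open>m\<close>, but nothing lies beyond
      it and the tail is 0.\<close>
    case False
    then have "block_start m (Suc i) + sz (Suc i) = n"
      using assms block_end[of "Suc i"] by auto
    then show ?thesis by (simp add: tail_frac_def)
  qed
  then have "far_phase t s i \<le> 1 * (1 / 2 ^ m)"
    unfolding far_phase_def using y tail_frac_bounds by (intro mult_mono) auto
  then show "far_phase t s i \<le> 1 / 2 ^ m" by simp
qed

text \<open>The qubits left of block \<open>i\<close> contribute an integral number of turns and
  disappear. The remaining fraction is cut twice, after block \<open>i\<close> and after block
  \<open>i + 1\<close>.\<close>

lemma block_phase_split:
  assumes i: "i < B"
  shows "expi (2 ^ block_start m i * real (Y i t) * real s / 2 ^ n) =
    expi (real (X i s) * real (Y i t) / 2 ^ sz i) *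
    (if i < B - 1 then phase i (X i t) (X (Suc i) s) * expi (far_phase t s i) else 1)"
proof -
  let ?a = "block_start m i"
  define q where "q = s div 2 ^ (n - ?a)"
  have a: "?a \<le> n" using block_end_le[OF i] by simp
  have "real s = real q * 2 ^ (n - ?a) + real (s mod 2 ^ (n - ?a))"
    unfolding q_def using div_mult_mod_eq[of s "2 ^ (n - ?a)"]
    by (metis of_nat_add of_nat_mult of_nat_power of_nat_numeral)
  moreover have "(2::real) ^ n = 2 ^ ?a * 2 ^ (n - ?a)"
    using a by (simp flip: power_add)
  ultimately have "2 ^ ?a * real (Y i t) * real s / 2 ^ n = real (Y i t * q) + real (Y i t) * tail_frac ?a s"
    by (simp add: tail_frac_def field_simps)
  also have "tail_frac ?a s = real (X i s) / 2 ^ sz i + tail_frac (?a + sz i) s / 2 ^ sz i"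
    unfolding tail_frac_def by (rule fraction_split[OF block_end_le[OF i]])
  finally have *: "expi (2 ^ ?a * real (Y i t) * real s / 2 ^ n) =
      expi (real (X i s) * real (Y i t) / 2 ^ sz i) * expi (real (Y i t) / 2 ^ sz i * tail_frac (?a + sz i) s)"
    by (simp only: distrib_left expi_add expi_of_nat mult_1_left) (simp add: mult.commute)
  show ?thesis
  proof (cases "i < B - 1")
    case True
    then have Suc: "Suc i < B" by simp
    have "tail_frac (?a + sz i) s = real (X (Suc i) s) / 2 ^ sz (Suc i) +
        tail_frac (block_start m (Suc i) + sz (Suc i)) s / 2 ^ sz (Suc i)"
      using block_end[OF i] Suc unfolding tail_frac_def
      by (simp only: if_True) (rule fraction_split[OF block_end_le[OF Suc]])
    then have "real (Y i t) / 2 ^ sz i * tail_frac (?a + sz i) s =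
        real (X (Suc i) s) * real (Y i t) / 2 ^ (sz i + sz (Suc i)) + far_phase t s i"
      by (simp only: distrib_left far_phase_def) (simp add: power_add)
    then have "expi (real (Y i t) / 2 ^ sz i * tail_frac (?a + sz i) s) =
        phase i (X i t) (X (Suc i) s) * expi (far_phase t s i)"
      by (simp only: expi_add phase_def Y_def)
    with * True show ?thesis by simp
  next
    case False
    then have "?a + sz i = n" using block_end[OF i] by auto
    then have "tail_frac (?a + sz i) s = 0" by (simp add: tail_frac_def)
    with * False show ?thesis by simp
  qed
qed

lemma prod_qft_scale: "(\<Prod>i<B. complex_of_real (2 powr (- real (sz i) / 2))) = of_real (2 powr (- real n / 2))"
proof -
  have "(\<Prod>i\<in>A. 2 powr (- real (sz i) / 2)) = 2 powr (- real (\<Sum>i\<in>A. sz i) / 2)" if "finite A" for A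
    using that by (induction A rule: finite_induct) (simp_all add: powr_add[symmetric] add_divide_distrib diff_divide_distrib)
  from this[of "{..<B}"] show ?thesis
    by (simp only: sum_block_sizes finite_lessThan flip: of_real_prod)
qed

text \<open>The output reading of the register is a weighted sum of block outputs, so the
  exponential factors over the blocks; the neighbour phases of both parities together are those of
  \<open>approx_QFT\<close>.\<close>

lemma QFT_entry:
  assumes ts: "t < 2 ^ n" "s < 2 ^ n"
  shows "QFT n $$ (t, s) = approx_QFT $$ (t, s) * expi (\<Sum>i<B - 1. far_phase t s i)"
proof -
  have out: "out_reading n 0 n t = (\<Sum>i<B. 2 ^ block_start m i * Y i t)"
    using out_reading_blocks[of B t] by (simp add: sum_block_sizes)
  have in_eq: "in_reading n 0 n s = s"
    using ts by (simp add: in_reading_eq)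
  have "QFT n $$ (t, s) = of_real (2 powr (- real n / 2)) *
      expi (real s * real (out_reading n 0 n t) / 2 ^ n)"
    using ts unfolding QFT_def QFT_on_def exp_eq_expi by (simp add: in_eq)
  also have "real s * real (out_reading n 0 n t) / 2 ^ n =
      (\<Sum>i<B. 2 ^ block_start m i * real (Y i t) * real s / 2 ^ n)"
    unfolding out by (simp add: sum_distrib_left sum_divide_distrib mult_ac)
  also have "expi \<dots> = (\<Prod>i<B. expi (real (X i s) * real (Y i t) / 2 ^ sz i) *
      (if i < B - 1 then phase i (X i t) (X (Suc i) s) * expi (far_phase t s i) else 1))"
    unfolding expi_sum by (intro prod.cong refl block_phase_split) simp
  also have "\<dots> = (\<Prod>i<B. expi (real (X i s) * real (Y i t) / 2 ^ sz i)) *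
      ((\<Prod>i<B - 1. phase i (X i t) (X (Suc i) s)) * (\<Prod>i<B - 1. expi (far_phase t s i)))"
  proof -
    have "(\<Prod>i<B. if i < B - 1 then phase i (X i t) (X (Suc i) s) * expi (far_phase t s i) else 1) =
        (\<Prod>i<B - 1. phase i (X i t) (X (Suc i) s) * expi (far_phase t s i))"
      by (rule prod.mono_neutral_cong_right) auto
    then show ?thesis by (simp only: prod.distrib)
  qed
  also have "(\<Prod>i<B - 1. phase i (X i t) (X (Suc i) s)) =
      pair_phase even_pairs t s * pair_phase odd_pairs t s"
  proof -
    have "{..<B - 1} = even_pairs \<union> odd_pairs" "even_pairs \<inter> odd_pairs = {}"
      by (auto simp: even_pairs_def odd_pairs_def)
    then show ?thesis by (simp add: pair_phase_def prod.union_disjoint)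
  qed
  also have "of_real (2 powr (- real n / 2)) * ((\<Prod>i<B. expi (real (X i s) * real (Y i t) / 2 ^ sz i)) *
      (pair_phase even_pairs t s * pair_phase odd_pairs t s * (\<Prod>i<B - 1. expi (far_phase t s i)))) =
      approx_QFT $$ (t, s) * expi (\<Sum>i<B - 1. far_phase t s i)"
    using ts prod_qft_scale
    by (simp add: approx_QFT_def one_sided_entry qft_kernel_def prod.distrib Y_def expi_sum
        del: of_real_prod)
  finally show ?thesis .
qed

lemma norm_approx_QFT_entry:
  assumes "t < 2 ^ n" "s < 2 ^ n"
  shows "(norm (approx_QFT $$ (t, s)))\<^sup>2 = 1 / 2 ^ n"
proof -
  have "(norm (approx_QFT $$ (t, s)))\<^sup>2 = (\<Prod>j<B. (norm (w j (X j t) (X j s)))\<^sup>2)"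
    using assms by (simp add: approx_QFT_def one_sided_entry norm_mult prod_power_distrib flip: prod_norm)
  also have "\<dots> = (\<Prod>j<B. 1 / 2 ^ sz j)"
    by (simp only: norm_qft_kernel_sq)
  also have "\<dots> = 1 / 2 ^ n"
    by (simp add: prod_dividef power_sum[symmetric] sum_block_sizes)
  finally show ?thesis .
qed

text \<open>All entries have squared modulus 1 / 2 ^ n, so a uniform bound on the relative phases is
  a bound on the normalised norm.\<close>

lemma frobenius_approx_QFT_le:
  "(frobenius_norm (approx_QFT - QFT n))\<^sup>2 \<le> 2 ^ n * (2 * pi * real n / 2 ^ m)\<^sup>2"
proof -
  have c: "QFT n \<in> carrier_mat (2 ^ n) (2 ^ n)" by (simp add: QFT_def QFT_on_def)
  then have D: "approx_QFT - QFT n \<in> carrier_mat (2 ^ n) (2 ^ n)" by (rule minus_carrier_mat)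
  have entry: "(norm ((approx_QFT - QFT n) $$ (t, s)))\<^sup>2 \<le> 1 / 2 ^ n * (2 * pi * real n / 2 ^ m)\<^sup>2"
    if ts: "t < 2 ^ n" "s < 2 ^ n" for t s
  proof -
    define R where "R = (\<Sum>i<B - 1. far_phase t s i)"
    have R: "0 \<le> R" unfolding R_def by (intro sum_nonneg far_phase_bounds) simp
    have "R \<le> (\<Sum>i<B - 1. 1 / 2 ^ m)" unfolding R_def by (intro sum_mono far_phase_bounds) simp
    also have "\<dots> = real (B - 1) / 2 ^ m" by simp
    also have "\<dots> \<le> real n / 2 ^ m" using num_blocks_bounds by (intro divide_right_mono) auto
    finally have "2 * pi * \<bar>0 - R\<bar> \<le> 2 * pi * (real n / 2 ^ m)"
      using R by (intro mult_left_mono) auto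
    then have "norm (expi 0 - expi R) \<le> 2 * pi * real n / 2 ^ m"
      using norm_expi_diff_le[of 0 R] by simp
    moreover have "(approx_QFT - QFT n) $$ (t, s) = approx_QFT $$ (t, s) * (expi 0 - expi R)"
      using ts c by (simp add: QFT_entry R_def algebra_simps)
    ultimately show ?thesis
      by (simp add: norm_mult power_mult_distrib norm_approx_QFT_entry[OF ts] divide_right_mono power_mono
          del: expi_0)
  qed
  have "(frobenius_norm (approx_QFT - QFT n))\<^sup>2 \<le>
      (\<Sum>s<(2::nat) ^ n. \<Sum>t<(2::nat) ^ n. 1 / 2 ^ n * (2 * pi * real n / 2 ^ m)\<^sup>2)"
    unfolding frobenius_norm_sq[OF D] by (intro sum_mono entry) auto
  also have "\<dots> = 2 ^ n * (2 * pi * real n / 2 ^ m)\<^sup>2"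
    by simp
  finally show ?thesis .
qed

end

section \<open>Total error and choice of the block size\<close>

lemma unitary_QFT: "1 \<le> n \<Longrightarrow> unitary_mat (2 ^ n) (QFT n)"
proof -
  assume n: "1 \<le> n"
  \<comment> \<open>A single block of all \<open>n\<close> qubits makes the QFT one tensor
    factor.\<close>
  interpret block_split n n by unfold_locales (use n in auto)
  have B: "num_blocks n n = 1" using n by (simp add: num_blocks_def)
  then have "QFT n = block_QFT n n 0"
    by (simp add: QFT_def block_QFT_def block_start_def block_size_def)
  then show ?thesis
    using B by (simp add: block_QFT_eq_tensor unitary_tensor unitary_kernel_on_blocks unitary_qft_kernel)
qed

text \<open>The constant is 80 = 2 * 24 + 2 * 16, with 24 from the circuit, 16 from the truncation
  and the doubling from the squared triangle inequality. Since m \<ge> 1, 4 pi^2 \<le> 64 \<le> 16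
  (m + 1)^2, whence 24 = 16 + 8.\<close>

lemma optimistic_QFT_error:
  assumes n: "1 \<le> n" and m: "1 \<le> m"
  shows "unitary_mat (2 ^ n) (induced_mat (2 ^ n) (optimistic_QFT n m))"
    "(frobenius_norm (induced_mat (2 ^ n) (optimistic_QFT n m) - QFT n))\<^sup>2
      \<le> 2 ^ n * (80 * (real n)\<^sup>2 * (real m + 1)\<^sup>2 / 2 ^ m)"
proof -
  interpret block_split n m by unfold_locales (use n m in auto)
  let ?V = "induced_mat (2 ^ n) (optimistic_QFT n m)"
  show V: "unitary_mat (2 ^ n) ?V"
    unfolding induced_optimistic_QFT by (rule unitary_circuit)
  have "pi\<^sup>2 \<le> 4\<^sup>2"
    using pi_less_4 by (intro power_mono) auto
  moreover have "2\<^sup>2 \<le> (real m + 1)\<^sup>2"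
    using m by (intro power_mono) auto
  ultimately have pi: "4 * pi\<^sup>2 \<le> 16 * (real m + 1)\<^sup>2"
    by simp
  then have "4 * pi\<^sup>2 + 8 * (real m + 1)\<^sup>2 \<le> 24 * (real m + 1)\<^sup>2"
    by simp
  then have K: "2 ^ n / 2 ^ m * (4 * pi\<^sup>2 + 8 * (real m + 1)\<^sup>2) \<le> 2 ^ n / 2 ^ m * (24 * (real m + 1)\<^sup>2)"
    by (intro mult_left_mono) auto
  have circ: "(frobenius_norm (?V - approx_QFT))\<^sup>2 \<le> 2 ^ n * (24 * (real n)\<^sup>2 * (real m + 1)\<^sup>2 / 2 ^ m)"
    unfolding induced_optimistic_QFT
    using frobenius_circuit_approx_le mult_left_mono[OF K, of "(real n)\<^sup>2"] by (simp add: mult_ac)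
  have "(2 * pi * real n / 2 ^ m)\<^sup>2 = 4 * pi\<^sup>2 * (real n)\<^sup>2 / (2 ^ m * 2 ^ m)"
    by (simp add: power2_eq_square)
  also have "\<dots> \<le> (16 * (real m + 1)\<^sup>2) * (real n)\<^sup>2 / (2 ^ m * 1)"
    using pi by (intro frac_le mult_left_mono mult_right_mono) auto
  finally have "(frobenius_norm (approx_QFT - QFT n))\<^sup>2 \<le> 2 ^ n * ((16 * (real m + 1)\<^sup>2) * (real n)\<^sup>2 / 2 ^ m)"
    by (intro order_trans[OF frobenius_approx_QFT_le] mult_left_mono) auto
  moreover have "(frobenius_norm (?V - QFT n))\<^sup>2 \<le>
      2 * (frobenius_norm (?V - approx_QFT))\<^sup>2 + 2 * (frobenius_norm (approx_QFT - QFT n))\<^sup>2"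
    using unitary_matD(1)[OF V] unitary_matD(1)[OF unitary_QFT[OF n]]
    by (intro frobenius_norm_triangle_sq[of _ "2 ^ n"]) auto
  ultimately have "(frobenius_norm (?V - QFT n))\<^sup>2 \<le> 2 * (2 ^ n * (24 * (real n)\<^sup>2 * (real m + 1)\<^sup>2 / 2 ^ m)) +
      2 * (2 ^ n * ((16 * (real m + 1)\<^sup>2) * (real n)\<^sup>2 / 2 ^ m))"
    using circ by linarith
  also have "\<dots> = 2 ^ n * (80 * (real n)\<^sup>2 * (real m + 1)\<^sup>2 / 2 ^ m)"
    by (simp add: field_simps)
  finally show "(frobenius_norm (?V - QFT n))\<^sup>2 \<le> 2 ^ n * (80 * (real n)\<^sup>2 * (real m + 1)\<^sup>2 / 2 ^ m)" .
qed

text \<open>For the block size m = 2 k this lets one of the two factors 2 ^ k of 2 ^ m absorb (m +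
  1)^2. The induction starts at 2 because only from there on does a step at most double the left
  side.\<close>

lemma odd_square_le: "(2 * real k + 1)\<^sup>2 \<le> 9 * 2 ^ k"
proof (cases "k \<le> 1")
  case True
  then have "k = 0 \<or> k = 1" by auto
  then show ?thesis by auto
next
  case False
  then have "2 \<le> k" by simp
  then show ?thesis
  proof (induction k rule: dec_induct)
    case (step k)
    have "2 * (2 * real k + 1)\<^sup>2 - (2 * real (Suc k) + 1)\<^sup>2 = 4 * (real k * (real k - 2)) + 4 * real k - 7"
      by (simp add: power2_eq_square algebra_simps)
    moreover have "real k * (real k - 2) \<ge> 0" "real k \<ge> 2"
      using step(1) by auto
    ultimately have "(2 * real (Suc k) + 1)\<^sup>2 \<le> 2 * (2 * real k + 1)\<^sup>2"
      by linarith
    with step show ?case by simp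
  qed simp
qed

theorem theorem3:
  shows "\<exists>C::real. \<forall>n::nat. \<forall>\<epsilon>::real. n \<ge> 2 \<and> 0 < \<epsilon> \<and> \<epsilon> < 1 \<longrightarrow>
    (\<exists>m::nat. 1 \<le> m \<and> real m \<le> C * ln (real n / \<epsilon>) \<and>
       optimistic_circuit (2 ^ n) \<epsilon> (optimistic_QFT n m) (QFT n))"
\<comment> \<open>The block size is 2 k with k \<le> 12 log_2 r + 1 \<le> 13 log_2 r, which gives
  26; ln 2 changes the base.\<close>
proof (intro exI[of _ "26 / ln 2"] allI impI)
  fix n :: nat and \<epsilon> :: real
  assume "n \<ge> 2 \<and> 0 < \<epsilon> \<and> \<epsilon> < 1"
  then have n: "n \<ge> 2" and \<epsilon>: "0 < \<epsilon>" "\<epsilon> < 1" by auto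
  define r where "r = real n / \<epsilon>"
  have "2 * \<epsilon> \<le> 2 * 1" using \<epsilon> by (intro mult_left_mono) auto
  then have r: "r \<ge> 2" using n \<epsilon> by (simp add: r_def le_divide_eq)
  have log_r: "1 \<le> log 2 r" using r by simp
  \<comment> \<open>12 = 10 + 2: since r \<ge> 2, r ^ 10 is at least 1024 and covers the constant
    720 = 80 * 9, while r ^ 2 remains for n^2 / \<epsilon>.\<close>
  define k where "k = nat \<lceil>12 * log 2 r\<rceil>"
  have k: "12 * log 2 r \<le> real k" "real k \<le> 12 * log 2 r + 1" "k \<ge> 1"
    using log_r unfolding k_def by linarith+
  have "r powr 12 = 2 powr (log 2 r * 12)"
    using r by (simp flip: powr_powr)
  also have "\<dots> \<le> 2 powr (real k)"
    using k by (intro powr_mono) auto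
  finally have r12: "r ^ 12 \<le> 2 ^ k"
    using r powr_realpow[of r 12] by (simp add: powr_realpow)
  have "2 ^ 10 * r\<^sup>2 \<le> r ^ 10 * r\<^sup>2"
    using r by (intro mult_right_mono power_mono) auto
  also have "\<dots> = r ^ 12" by (simp flip: power_add)
  finally have "1024 * r\<^sup>2 \<le> 2 ^ k" using r12 by simp
  then have k2: "720 * r\<^sup>2 \<le> 2 ^ k" using zero_le_power2[of r] by linarith
  \<comment> \<open>Here \<epsilon> r^2 = n^2 / \<epsilon>; this form exposes the factor \<epsilon>
    of the target.\<close>
  have "(real n)\<^sup>2 \<le> \<epsilon> * r\<^sup>2"
  proof -
    have "(real n)\<^sup>2 * \<epsilon> \<le> (real n)\<^sup>2 * 1" using \<epsilon> by (intro mult_left_mono) auto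
    then show ?thesis using \<epsilon> by (simp add: r_def power2_eq_square field_simps)
  qed
  then have "80 * (real n)\<^sup>2 * (2 * real k + 1)\<^sup>2 \<le> 80 * (\<epsilon> * r\<^sup>2) * (9 * 2 ^ k)"
    using \<epsilon> by (intro mult_mono odd_square_le) auto
  also have "\<dots> = \<epsilon> * (720 * r\<^sup>2) * 2 ^ k" by simp
  also have "\<dots> \<le> \<epsilon> * 2 ^ k * 2 ^ k"
    using k2 \<epsilon> by (intro mult_right_mono mult_left_mono) auto
  finally have "80 * (real n)\<^sup>2 * (real (2 * k) + 1)\<^sup>2 \<le> \<epsilon> * 2 ^ (2 * k)"
    by (simp only: mult_2 power_add of_nat_add mult.assoc)
  then have err: "80 * (real n)\<^sup>2 * (real (2 * k) + 1)\<^sup>2 / 2 ^ (2 * k) \<le> \<epsilon>"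
    by (subst pos_divide_le_eq) auto
  show "\<exists>m. 1 \<le> m \<and> real m \<le> 26 / ln 2 * ln (real n / \<epsilon>) \<and>
      optimistic_circuit (2 ^ n) \<epsilon> (optimistic_QFT n m) (QFT n)"
  proof (intro exI[of _ "2 * k"] conjI)
    show "1 \<le> 2 * k" using k(3) by simp
    show "real (2 * k) \<le> 26 / ln 2 * ln (real n / \<epsilon>)"
    proof -
      have "real (2 * k) \<le> 26 * log 2 r" using k(2) log_r by simp
      then show ?thesis by (simp add: log_def r_def)
    qed
    have "1 \<le> n" "1 \<le> 2 * k" using n k(3) by auto
    note error = optimistic_QFT_error[OF this]
    have "(frobenius_norm (induced_mat (2 ^ n) (optimistic_QFT n (2 * k)) - QFT n))\<^sup>2 \<le> 2 ^ n * \<epsilon>"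
      using order_trans[OF error(2) mult_left_mono[OF err, of "2 ^ n"]] by simp
    then show "optimistic_circuit (2 ^ n) \<epsilon> (optimistic_QFT n (2 * k)) (QFT n)"
      using error(1) unitary_QFT[OF \<open>1 \<le> n\<close>]
      by (simp add: optimistic_circuit_def divide_le_eq mult.commute)
  qed
qed

end
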